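(* Let $T=2\pi$. Let $h:\mathbb{R}\to\{-1,1\}$ be the $2\pi$-periodic function with $h=-1$ on $[0,\pi)$ and $h=1$ on $[\pi,2\pi)$, and let $$G=\{(t,x)\in[0,2\pi]\times[0,2\pi]:\ h(x+t)=h(x-t)\}.$$ Then $G$ satisfies (GCC), but observability fails on $G$: there is no constant $C>0$ such that every solution $u$ of $(\partial_t^2-\partial_x^2)u=0$, $(u,\partial_t u)|_{t=0}=(u_0,u_1)\in H^1(\mathbb{T})\times L^2(\mathbb{T})$, satisfies $$\|\partial_x u_0\|_{L^2(\mathbb{T})}^2+\|u_1\|_{L^2(\mathbb{T})}^2\le C\iint_G|\partial_t u(t,x)|^2\,dx\,dt.$$
   Context: $\mathbb{T}=\mathbb{R}/2\pi\mathbb{Z}$, and functions on $\mathbb{T}$ are identified with $2\pi$-periodic functions on $\mathbb{R}$. The solution $u$ is the unique one with $(u,\partial_t u)\in C([0,T];H^1(\mathbb{T})\times L^2(\mathbb{T}))$. $\mathrm{meas}_{\mathbb{R}}$ of a subset of a line in the plane is one-dimensional Lebesgue (arclength) measure. (GCC): a measurable $G\subset[0,T]\times[0,2\pi]$ satisfies (GCC) if there exists $c_0>0$ such that for almost every $x\in[0,2\pi]$, $$\mathrm{meas}_{\mathbb{R}}\big(G\cap\{(s,x+s):s\in[0,T]\}\big)\ge c_0,\qquad \mathrm{meas}_{\mathbb{R}}\big(G\cap\{(s,x-s):s\in[0,T]\}\big)\ge c_0,$$ where $(t,x+2k\pi)$ is identified with $(t,x)$ for all $k\in\mathbb{Z}$.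 *)

theory Defs
  imports "HOL-Analysis.Analysis"
begin

section \<open>Function spaces on the torus of length $2\pi$\<close>

text \<open>Functions on the torus are real-valued \<open>2\<pi>\<close>-periodic functions on the line. Elements of
  \<open>L2T\<close> and \<open>H1T\<close> are representatives, so the norms below are seminorms whose kernel consists of
  the functions vanishing almost everywhere.\<close>

definition periodic :: "(real \<Rightarrow> real) \<Rightarrow> bool" where
  "periodic f \<longleftrightarrow> (\<forall>x. f (x + 2 * pi) = f x)"

definition L2T :: "(real \<Rightarrow> real) set" where
  "L2T = {f. periodic f \<and> f \<in> borel_measurable lebesgue
             \<and> set_integrable lebesgue {0..2 * pi} (\<lambda>x. (f x)\<^sup>2)}"

definition L2_norm :: "(real \<Rightarrow> real) \<Rightarrow> real" where
  "L2_norm f = sqrt (LINT x:{0..2 * pi}|lebesgue. (f x)\<^sup>2)"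

definition test_fun :: "(real \<Rightarrow> real) \<Rightarrow> bool" where
  "test_fun \<phi> \<longleftrightarrow> periodic \<phi> \<and> (\<forall>n. (deriv ^^ n) \<phi> differentiable_on UNIV)"

definition has_weak_deriv :: "(real \<Rightarrow> real) \<Rightarrow> (real \<Rightarrow> real) \<Rightarrow> bool" where
  "has_weak_deriv f g \<longleftrightarrow>
     (\<forall>\<phi>. test_fun \<phi> \<longrightarrow>
        (LINT x:{0..2 * pi}|lebesgue. f x * deriv \<phi> x) =
        - (LINT x:{0..2 * pi}|lebesgue. g x * \<phi> x))"

definition H1T :: "(real \<Rightarrow> real) set" where
  "H1T = {f \<in> L2T. \<exists>g \<in> L2T. has_weak_deriv f g}"

text \<open>The weak derivative is unique only up to null sets; \<open>weak_deriv\<close> picks a representative.\<close>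

definition weak_deriv :: "(real \<Rightarrow> real) \<Rightarrow> (real \<Rightarrow> real)" where
  "weak_deriv f = (SOME g. g \<in> L2T \<and> has_weak_deriv f g)"

definition H1_norm :: "(real \<Rightarrow> real) \<Rightarrow> real" where
  "H1_norm f = sqrt ((L2_norm f)\<^sup>2 + (L2_norm (weak_deriv f))\<^sup>2)"

section \<open>Solutions of the wave equation\<close>

text \<open>Space-time functions are curried, time first.\<close>

definition dt :: "(real \<Rightarrow> real \<Rightarrow> real) \<Rightarrow> (real \<Rightarrow> real \<Rightarrow> real)" where
  "dt \<phi> = (\<lambda>t x. deriv (\<lambda>s. \<phi> s x) t)"

definition dx :: "(real \<Rightarrow> real \<Rightarrow> real) \<Rightarrow> (real \<Rightarrow> real \<Rightarrow> real)" where
  "dx \<phi> = (\<lambda>t x. deriv (\<phi> t) x)"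

fun iter_partial :: "bool list \<Rightarrow> (real \<Rightarrow> real \<Rightarrow> real) \<Rightarrow> (real \<Rightarrow> real \<Rightarrow> real)" where
  "iter_partial [] \<phi> = \<phi>"
| "iter_partial (b # bs) \<phi> = (if b then dt else dx) (iter_partial bs \<phi>)"

text \<open>Smoothness is total differentiability of all iterated partial derivatives. The support
  condition says that the support is a compact subset of the product of the open interval
  \<open>(0, T)\<close> with the torus.\<close>

definition test_fun2 :: "real \<Rightarrow> (real \<Rightarrow> real \<Rightarrow> real) \<Rightarrow> bool" where
  "test_fun2 T \<phi> \<longleftrightarrow>
     (\<forall>bs. (\<lambda>(t, x). iter_partial bs \<phi> t x) differentiable_on UNIV) \<and>
     (\<forall>t. periodic (\<phi> t)) \<and>
     (\<exists>a b. 0 < a \<and> b < T \<and> (\<forall>t x. t \<notin> {a..b} \<longrightarrow> \<phi> t x = 0))"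

definition pairing :: "real \<Rightarrow> (real \<Rightarrow> real \<Rightarrow> real) \<Rightarrow> (real \<Rightarrow> real \<Rightarrow> real) \<Rightarrow> real" where
  "pairing T u \<phi> = (LINT (t, x):{0..T} \<times> {0..2 * pi}|lebesgue. u t x * \<phi> t x)"

definition has_weak_dt ::
  "real \<Rightarrow> (real \<Rightarrow> real \<Rightarrow> real) \<Rightarrow> (real \<Rightarrow> real \<Rightarrow> real) \<Rightarrow> bool" where
  "has_weak_dt T u v \<longleftrightarrow>
     (\<forall>\<phi>. test_fun2 T \<phi> \<longrightarrow> pairing T u (dt \<phi>) = - pairing T v \<phi>)"

definition weak_wave_eq :: "real \<Rightarrow> (real \<Rightarrow> real \<Rightarrow> real) \<Rightarrow> bool" where
  "weak_wave_eq T u \<longleftrightarrow>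
     (\<forall>\<phi>. test_fun2 T \<phi> \<longrightarrow>
        pairing T u (\<lambda>t x. dt (dt \<phi>) t x - dx (dx \<phi>) t x) = 0)"

definition continuous_path ::
  "((real \<Rightarrow> real) \<Rightarrow> real) \<Rightarrow> real \<Rightarrow> (real \<Rightarrow> real \<Rightarrow> real) \<Rightarrow> bool" where
  "continuous_path N T w \<longleftrightarrow>
     (\<forall>t\<in>{0..T}. ((\<lambda>s. N (\<lambda>x. w s x - w t x)) \<longlongrightarrow> 0) (at t within {0..T}))"

text \<open>In \<open>wave_solution T u0 u1 u v\<close> the function \<open>v\<close> is the time derivative of \<open>u\<close>.
  A path in \<open>L2T\<close> fixes each time slice only up to a null set, so the joint measurability
  conditions select representatives that are genuine functions of space-time; without them the
  space-time integrals would be meaningless.\<close>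

definition wave_solution ::
  "real \<Rightarrow> (real \<Rightarrow> real) \<Rightarrow> (real \<Rightarrow> real) \<Rightarrow>
   (real \<Rightarrow> real \<Rightarrow> real) \<Rightarrow> (real \<Rightarrow> real \<Rightarrow> real) \<Rightarrow> bool" where
  "wave_solution T u0 u1 u v \<longleftrightarrow>
     (\<lambda>(t, x). u t x) \<in> borel_measurable (lebesgue_on ({0..T} \<times> UNIV)) \<and>
     (\<lambda>(t, x). v t x) \<in> borel_measurable (lebesgue_on ({0..T} \<times> UNIV)) \<and>
     (\<forall>t\<in>{0..T}. u t \<in> H1T \<and> v t \<in> L2T) \<and>
     continuous_path H1_norm T u \<and>
     continuous_path L2_norm T v \<and>
     has_weak_dt T u v \<and>
     weak_wave_eq T u \<and>
     (AE x in lebesgue. u 0 x = u0 x) \<and>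
     (AE x in lebesgue. v 0 x = u1 x)"

section \<open>The geometric control condition\<close>

text \<open>Arclength measure, on the line through \<open>p\<close> with direction \<open>d \<noteq> 0\<close>, of the part of \<open>A\<close>
  lying on that line.\<close>

definition line_meas :: "real \<times> real \<Rightarrow> real \<times> real \<Rightarrow> (real \<times> real) set \<Rightarrow> ennreal" where
  "line_meas p d A = ennreal (norm d) * emeasure lebesgue {r. p + r *\<^sub>R d \<in> A}"

text \<open>Preimage of \<open>G\<close> under the identification of \<open>(t, x + 2k\<pi>)\<close> with \<open>(t, x)\<close>.\<close>

definition periodize :: "(real \<times> real) set \<Rightarrow> (real \<times> real) set" where
  "periodize G = {(t, x). \<exists>k::int. (t, x + 2 * of_int k * pi) \<in> G}"

definition GCC :: "real \<Rightarrow> (real \<times> real) set \<Rightarrow> bool" where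
  "GCC T G \<longleftrightarrow>
     G \<in> sets lebesgue \<and> G \<subseteq> {0..T} \<times> {0..2 * pi} \<and>
     (\<exists>c0>0. AE x\<in>{0..2 * pi} in lebesgue.
        line_meas (0, x) (1, 1) (periodize G \<inter> {(s, x + s) |s. s \<in> {0..T}}) \<ge> ennreal c0 \<and>
        line_meas (0, x) (1, -1) (periodize G \<inter> {(s, x - s) |s. s \<in> {0..T}}) \<ge> ennreal c0)"

end

theory Submission
  imports Defs
begin

text \<open>Take \<open>U\<close> to be the triangle wave with \<open>U' = h\<close> and \<open>u t x = U (x + t) + U (x - t)\<close>, a solution of
  finite energy with \<open>\<partial>\<^sub>t u t x = h (x + t) - h (x - t)\<close>. This vanishes identically on \<open>G\<close>, whereas the
  initial energy is \<open>8\<pi>\<close>. Each characteristic spends time at least \<open>\<pi>/2\<close> in \<open>G\<close>, because the argument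
  of \<open>h\<close> that varies along it runs through the half-period containing the fixed argument.

  As \<open>U\<close> is only Lipschitz, the weak wave equation is verified by one integration by parts in each
  variable and then by integrating along characteristics. The \<open>H\<^sup>1\<close> norm of a difference of time
  slices involves an arbitrarily chosen weak derivative, so uniqueness of weak derivatives is
  needed; it follows from the density of trigonometric polynomials.\<close>

section \<open>Uniqueness of weak derivatives\<close>

text \<open>(GCC) inspects the two families of characteristics separately, so it cannot exclude that
  a left-moving and a right-moving wave cancel wherever they are observed; \<open>G\<close> is
  exactly the set where the two contributions \<open>h (x + t)\<close> and \<open>h (x - t)\<close>
  cancel. That \<open>h\<close> takes only two values makes this set large: with one argument fixed,
  equality holds on a whole half-period of the other. The price is a profile with corners, so the
  solution is not classical and every clause of \<open>wave_solution\<close> is checked weakly or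
  almost everywhere. For uniqueness of weak derivatives, the real polynomials in
  \<open>cis x\<close> serve as test functions because their derivatives are explicit;
  Stone-Weierstrass on the circle then takes the place of mollification.\<close>

lemma borel_measurable_lebesgueI:
  "f \<in> borel_measurable borel \<Longrightarrow> f \<in> borel_measurable lebesgue"
  by (simp add: measurable_completion)

lemma borel_measurable_lebesgue_indicator_Icc [measurable]:
  "indicat_real {a..b::real} \<in> borel_measurable lebesgue"
  by (intro borel_measurable_lebesgueI borel_measurable_indicator) simp

text \<open>The velocity of \<open>cis\<close> at \<open>x\<close> is \<open>\<i> * cis x\<close>, a
  linear function of the point itself, so differentiating a linear form gives a linear form; sum and
  product rules extend this to polynomials.\<close>

lemma real_polynomial_function_cis_deriv:
  assumes "real_polynomial_function p"
  shows "\<exists>q. real_polynomial_function q \<and>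
    (\<forall>x. ((\<lambda>x. p (cis x)) has_real_derivative q (cis x)) (at x))"
  using assms
proof induction
  case (linear f)
  have cis: "(cis has_vector_derivative \<i> * cis x) (at x)" for x
    unfolding has_vector_derivative_def by (auto intro!: derivative_eq_intros)
  have "real_polynomial_function (\<lambda>z. f (\<i> * z))"
    by (intro real_polynomial_function.intros(1) bounded_linear_compose[OF linear] bounded_linear_mult_right)
  moreover have "((\<lambda>x. f (cis x)) has_real_derivative f (\<i> * cis x)) (at x)" for x
    using bounded_linear.has_vector_derivative[OF linear cis]
    by (simp add: has_real_derivative_iff_has_vector_derivative)
  ultimately show ?case by blast
next
  case (const c)
  have "real_polynomial_function (\<lambda>_::complex. 0)" by (rule real_polynomial_function.intros)
  then show ?case by (auto intro!: exI[of _ "\<lambda>_. 0"])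
next
  case (add f g)
  then obtain f' g' where "real_polynomial_function f'" "real_polynomial_function g'"
    "\<And>x. ((\<lambda>x. f (cis x)) has_real_derivative f' (cis x)) (at x)"
    "\<And>x. ((\<lambda>x. g (cis x)) has_real_derivative g' (cis x)) (at x)" by blast
  then show ?case
    by (intro exI[of _ "\<lambda>z. f' z + g' z"])
       (auto intro!: derivative_eq_intros real_polynomial_function.intros(3))
next
  case (mult f g)
  then obtain f' g' where "real_polynomial_function f'" "real_polynomial_function g'"
    "\<And>x. ((\<lambda>x. f (cis x)) has_real_derivative f' (cis x)) (at x)"
    "\<And>x. ((\<lambda>x. g (cis x)) has_real_derivative g' (cis x)) (at x)" by blast
  with mult.hyps show ?case
    by (intro exI[of _ "\<lambda>z. f' z * g z + g' z * f z"])
       (auto intro!: derivative_eq_intros real_polynomial_function.intros(3,4))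
qed

lemma test_fun_real_polynomial_function_cis:
  assumes "real_polynomial_function p"
  shows "test_fun (\<lambda>x. p (cis x))"
proof -
  have "\<exists>q. real_polynomial_function q \<and> (deriv ^^ n) (\<lambda>x. p (cis x)) = (\<lambda>x. q (cis x))" for n
  proof (induction n)
    case (Suc n)
    then obtain q where q: "real_polynomial_function q"
      "(deriv ^^ n) (\<lambda>x. p (cis x)) = (\<lambda>x. q (cis x))" by blast
    obtain r where r: "real_polynomial_function r"
      "\<And>x. ((\<lambda>x. q (cis x)) has_real_derivative r (cis x)) (at x)"
      using real_polynomial_function_cis_deriv[OF q(1)] by blast
    then have "deriv (\<lambda>x. q (cis x)) = (\<lambda>x. r (cis x))"
      by (auto intro!: DERIV_imp_deriv)
    with r(1) q(2) show ?case by auto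
  qed (use assms in auto)
  moreover have "(\<lambda>x. q (cis x)) differentiable_on UNIV" if "real_polynomial_function q" for q
    using real_polynomial_function_cis_deriv[OF that]
    by (auto simp: differentiable_on_def real_differentiable_def)
  ultimately show ?thesis
    unfolding test_fun_def periodic_def
    by (metis cis_mult cis_2pi mult.right_neutral)
qed

text \<open>On an interval of finite length, square integrability gives integrability, through the
  pointwise bound of \<open>\<bar>y\<bar>\<close> by 1 plus the square of \<open>y\<close>.\<close>

lemma set_integrable_L2T:
  assumes "g \<in> L2T"
  shows "set_integrable lebesgue {0..2 * pi} g"
proof -
  have "set_integrable lebesgue {0..2 * pi} (\<lambda>x. (g x)\<^sup>2)" and [measurable]: "g \<in> borel_measurable lebesgue"
    using assms by (auto simp: L2T_def)
  then have "integrable lebesgue (\<lambda>x. indicator {0..2 * pi} x + indicator {0..2 * pi} x * (g x)\<^sup>2)"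
    by (auto simp: set_integrable_def)
  then show ?thesis
    unfolding set_integrable_def
  proof (rule Bochner_Integration.integrable_bound, goal_cases)
    case 2
    have "\<bar>y\<bar> \<le> 1 + y\<^sup>2" for y :: real
      using zero_le_power2[of "\<bar>y\<bar> - 1"] by (simp add: power2_eq_square algebra_simps)
    then show ?case by (auto simp: indicator_def)
  qed (auto intro!: borel_measurable_times)
qed


lemma set_integrable_L2T_mult_continuous:
  assumes "g \<in> L2T" and c: "continuous_on UNIV \<phi>"
  shows "set_integrable lebesgue {0..2 * pi} (\<lambda>x. g x * \<phi> x)"
proof -
  obtain B where B: "\<And>x. x \<in> {0..2 * pi} \<Longrightarrow> \<bar>\<phi> x\<bar> \<le> B"
    using compact_imp_bounded[OF compact_continuous_image[OF continuous_on_subset[OF c] compact_Icc[of 0 "2 * pi"]]]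
    by (force simp: bounded_iff)
  have [measurable]: "\<phi> \<in> borel_measurable lebesgue" "g \<in> borel_measurable lebesgue"
    using assms(1) by (auto simp: L2T_def intro: borel_measurable_lebesgueI borel_measurable_continuous_onI[OF c])
  show ?thesis
    unfolding set_integrable_def
  proof (rule Bochner_Integration.integrable_bound[of _ "\<lambda>x. B * (indicator {0..2 * pi} x * g x)"])
    show "integrable lebesgue (\<lambda>x. B * (indicator {0..2 * pi} x * g x))"
      using set_integrable_L2T[OF assms(1)] by (auto simp: set_integrable_def)
    have "\<bar>g x\<bar> * \<bar>\<phi> x\<bar> \<le> \<bar>B\<bar> * \<bar>g x\<bar>" if "x \<in> {0..2 * pi}" for x
      using B[OF that] by (subst mult.commute) (intro mult_right_mono, auto)
    then show "AE x in lebesgue. norm (indicator {0..2 * pi} x *\<^sub>R (g x * \<phi> x))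
        \<le> norm (B * (indicator {0..2 * pi} x * g x))"
      by (intro AE_I2) (auto simp: abs_mult indicator_def)
  qed simp
qed

text \<open>A polynomial \<open>p\<close> uniformly close to \<open>F\<close> on the unit circle
  gives a test function, against which \<open>g\<close> integrates to 0; only the error
  \<open>F - p\<close>, weighted by the L1 norm of \<open>g\<close>, is left.\<close>

lemma integral_cis_continuous_eq_0:
  fixes g :: "real \<Rightarrow> real" and F :: "complex \<Rightarrow> real"
  assumes g: "integrable lebesgue g"
    and test: "\<And>\<phi>. test_fun \<phi> \<Longrightarrow> (LINT x|lebesgue. g x * \<phi> x) = 0"
    and F: "continuous_on UNIV F"
  shows "(LINT x|lebesgue. g x * F (cis x)) = 0"
proof (rule ccontr)
  let ?J = "LINT x|lebesgue. g x * F (cis x)"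
  define K where "K = (LINT x|lebesgue. \<bar>g x\<bar>)"
  have K: "K \<ge> 0" by (simp add: K_def)
  assume J: "?J \<noteq> 0"
  \<comment> \<open>Accuracy \<open>e\<close> bounds the integral by \<open>e * K\<close>, strictly
    less than \<open>e * (K + 1)\<close>, which is its own absolute value. The added 1 also covers
    \<open>K = 0\<close>.\<close>
  define e where "e = \<bar>?J\<bar> / (K + 1)"
  have e: "e > 0" using J K by (simp add: e_def)
  obtain p where p: "real_polynomial_function p"
    and close: "\<And>z. z \<in> sphere 0 1 \<Longrightarrow> \<bar>F z - p z\<bar> < e"
    using Stone_Weierstrass_real_polynomial_function[of "sphere 0 1" F e] F e
    by (metis compact_sphere continuous_on_subset subset_UNIV)
  have F_borel [measurable]: "F \<in> borel_measurable borel"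
    by (rule borel_measurable_continuous_onI[OF F])
  have p_borel [measurable]: "p \<in> borel_measurable borel"
    using continuous_real_polymonial_function[OF p]
    by (intro borel_measurable_continuous_onI) (simp add: continuous_at_imp_continuous_on)
  have cis_borel [measurable]: "cis \<in> borel_measurable borel"
    by (intro borel_measurable_continuous_onI continuous_intros)
  have [measurable]: "(\<lambda>x. F (cis x) - p (cis x)) \<in> borel_measurable lebesgue"
    "(\<lambda>x. p (cis x)) \<in> borel_measurable lebesgue"
    by (intro borel_measurable_lebesgueI; measurable)+
  obtain B where B: "\<And>z. z \<in> sphere 0 1 \<Longrightarrow> \<bar>F z\<bar> \<le> B"
  proof -
    have "compact (F ` sphere 0 1)"
      by (intro compact_continuous_image compact_sphere continuous_on_subset[OF F]) auto
    then show ?thesis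
      using that compact_imp_bounded by (force simp: bounded_iff)
  qed
  have iF: "integrable lebesgue (\<lambda>x. g x * (F (cis x) - p (cis x)))"
  proof (rule Bochner_Integration.integrable_bound[of _ "\<lambda>x. e * g x"])
    show "AE x in lebesgue. norm (g x * (F (cis x) - p (cis x))) \<le> norm (e * g x)"
      using less_imp_le[OF close[of "cis _"]] e by (auto simp: abs_mult mult.commute[of e] intro!: AE_I2 mult_left_mono)
  qed (use g in auto)
  have ip: "integrable lebesgue (\<lambda>x. g x * p (cis x))"
  proof (rule Bochner_Integration.integrable_bound[of _ "\<lambda>x. (B + e) * g x"])
    have "\<bar>p (cis x)\<bar> \<le> \<bar>B + e\<bar>" for x
      using close[of "cis x"] B[of "cis x"] by auto
    then show "AE x in lebesgue. norm (g x * p (cis x)) \<le> norm ((B + e) * g x)"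
      by (auto simp: abs_mult mult.commute[of "\<bar>B + e\<bar>"] intro!: AE_I2 mult_left_mono)
  qed (use g in auto)
  have "?J = (LINT x|lebesgue. g x * (F (cis x) - p (cis x)) + g x * p (cis x))"
    by (simp add: algebra_simps)
  also have "\<dots> = (LINT x|lebesgue. g x * (F (cis x) - p (cis x)))"
    using iF ip test[OF test_fun_real_polynomial_function_cis[OF p]] by (subst Bochner_Integration.integral_add) auto
  finally have "\<bar>?J\<bar> \<le> (LINT x|lebesgue. \<bar>g x * (F (cis x) - p (cis x))\<bar>)"
    using integral_abs_bound by metis
  also have "\<dots> \<le> (LINT x|lebesgue. e * \<bar>g x\<bar>)"
    using less_imp_le[OF close[of "cis _"]] integrable_abs[OF iF] g
    by (intro integral_mono) (auto simp: abs_mult mult.commute[of e] intro!: mult_left_mono)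
  also have "\<dots> = e * K" by (simp add: K_def)
  also have "\<dots> < e * (K + 1)" using e by simp
  also have "\<dots> = \<bar>?J\<bar>" using K by (simp add: e_def)
  finally show False by simp
qed

lemma inj_on_cis: "inj_on cis {0<..<2 * pi}"
proof (rule inj_onI)
  fix x y :: real assume *: "x \<in> {0<..<2 * pi}" "y \<in> {0<..<2 * pi}" "cis x = cis y"
  then have "sin x = sin y \<and> cos x = cos y" by (auto simp: complex_eq_iff)
  then obtain n :: int where "x = y + 2 * pi * n" unfolding sin_cos_eq_iff by auto
  moreover have "x < 2 * pi" "0 < x" "y < 2 * pi" "0 < y" using * by auto
  ultimately have "(-1) * (2 * pi) < real_of_int n * (2 * pi)" "real_of_int n * (2 * pi) < 1 * (2 * pi)"
    by (auto simp only: mult.commute)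
  then have "n = 0" unfolding mult_less_cancel_right_pos[OF pi_gt_zero[THEN mult_pos_pos[OF zero_less_numeral]]] by simp
  with \<open>x = y + 2 * pi * n\<close> show "x = y" by simp
qed

text \<open>Inner regularity: a compact \<open>K \<subseteq> {0<..<2\<pi>}\<close> embeds in the circle, so its indicator is a
  limit of continuous functions of \<open>cis x\<close>.\<close>

lemma test_fun_orthogonal_nonpos:
  fixes g :: "real \<Rightarrow> real"
  assumes g: "integrable lebesgue g" and supp: "\<And>x. x \<notin> {0<..<2 * pi} \<Longrightarrow> g x = 0"
    and test: "\<And>\<phi>. test_fun \<phi> \<Longrightarrow> (LINT x|lebesgue. g x * \<phi> x) = 0"
  shows "AE x in lebesgue. g x \<le> 0"
proof (rule ccontr)
  assume *: "\<not> (AE x in lebesgue. g x \<le> 0)"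
  define S where "S = {x. g x > 0}"
  have [measurable]: "g \<in> borel_measurable lebesgue" using g by auto
  have "{x \<in> space lebesgue. g x > 0} \<in> sets lebesgue" by measurable
  then have S: "S \<in> sets lebesgue" by (simp add: S_def)
  have "emeasure lebesgue S \<noteq> 0"
    using * S by (subst (asm) AE_iff_null) (auto simp: S_def not_le null_sets_def)
  then obtain z where z: "0 < z" "z < emeasure lebesgue S"
    using dense[of 0 "emeasure lebesgue S"] by (auto simp: zero_less_iff_neq_zero)
  \<comment> \<open>A finite \<open>e\<close> below the measure of \<open>S\<close> is the
    admissible loss: a closed subset missing less than \<open>e\<close> keeps positive
    measure.\<close>
  then obtain e :: real where e: "e > 0" "ennreal e < emeasure lebesgue S"
    by (cases z) auto
  obtain K where K: "closed K" "K \<subseteq> S" "emeasure lebesgue (S - K) < ennreal e"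
    using sets_lebesgue_inner_closed[OF S e(1)] by metis
  have Kb: "K \<subseteq> {0<..<2 * pi}" using K(2) supp by (force simp: S_def)
  then have "bounded K" by (rule bounded_subset[OF bounded_closed_interval[of 0 "2 * pi"], OF order_trans]) auto
  with K have "compact K" by (simp add: compact_eq_bounded_closed)
  then have cK: "closed (cis ` K)"
    by (intro compact_imp_closed compact_continuous_image continuous_intros)
  have [measurable]: "K \<in> sets lebesgue" using K by (auto simp: borel_closed)
  have posK: "emeasure lebesgue K \<noteq> 0"
  proof
    assume "emeasure lebesgue K = 0"
    then have "emeasure lebesgue S \<le> emeasure lebesgue (S - K)"
      using K(2) S emeasure_subadditive[of "S - K" lebesgue K] by (simp add: Un_absorb2)
    with K e show False by (meson leD order.strict_trans)
  qed
  then have ne: "cis ` K \<noteq> {}" by auto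
  define F where "F n z = max 0 (1 - real n * infdist z (cis ` K))" for n z
  have F: "continuous_on UNIV (F n)" for n
    unfolding F_def by (intro continuous_intros)
  have [measurable]: "(\<lambda>x. F n (cis x)) \<in> borel_measurable lebesgue" for n
    by (intro borel_measurable_lebesgueI borel_measurable_continuous_onI)
       (auto intro!: continuous_on_compose2[OF F] continuous_intros)
  have lim: "(\<lambda>n. g x * F n (cis x)) \<longlonglongrightarrow> g x * indicator K x" for x
  proof (cases "x \<in> {0<..<2 * pi}")
    case True
    show ?thesis
    proof (cases "x \<in> K")
      case False
      then have "cis x \<notin> cis ` K"
        using True Kb inj_on_cis by (meson inj_on_image_mem_iff)
      then have d: "infdist (cis x) (cis ` K) > 0"
        using cK ne by (simp add: infdist_pos_not_in_closed)
      obtain N where N: "1 < real N * infdist (cis x) (cis ` K)"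
        using reals_Archimedean3[OF d] by auto
      have "F n (cis x) = 0" if "n \<ge> N" for n
      proof -
        have "real N * infdist (cis x) (cis ` K) \<le> real n * infdist (cis x) (cis ` K)"
          using that d by (intro mult_right_mono) auto
        then show ?thesis using N unfolding F_def by linarith
      qed
      then have "\<forall>\<^sub>F n in sequentially. g x * F n (cis x) = g x * indicator K x"
        using False by (auto simp: eventually_sequentially)
      then show ?thesis by (rule tendsto_eventually)
    qed (simp add: F_def)
  qed (simp add: supp)
  have "(\<lambda>n. LINT x|lebesgue. g x * F n (cis x)) \<longlonglongrightarrow> (LINT x|lebesgue. g x * indicator K x)"
  proof (rule integral_dominated_convergence)
    have "\<bar>F n z\<bar> \<le> 1" for n z by (auto simp: F_def infdist_nonneg)
    then show "AE x in lebesgue. norm (g x * F n (cis x)) \<le> norm (g x)" for n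
      by (auto simp: abs_mult intro!: AE_I2 mult_left_le)
  qed (use g lim in auto)
  then have "(\<lambda>n::nat. 0::real) \<longlonglongrightarrow> (LINT x|lebesgue. g x * indicator K x)"
    using integral_cis_continuous_eq_0[OF g test F] by simp
  then have "(LINT x|lebesgue. g x * indicator K x) = 0"
    using LIMSEQ_unique tendsto_const by blast
  moreover have "g x * indicator K x \<ge> 0" for x
    using K(2) by (auto simp: S_def indicator_def)
  moreover have "integrable lebesgue (\<lambda>x. g x * indicator K x)"
    using integrable_mult_indicator[OF _ g, of K] by (simp add: mult.commute)
  \<comment> \<open>Since \<open>g\<close> is strictly positive on \<open>K\<close>, a vanishing
    integral over \<open>K\<close> makes \<open>K\<close> a null set, against
    \<open>posK\<close>.\<close>
  ultimately have "AE x in lebesgue. g x * indicator K x = 0"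
    by (subst (asm) integral_nonneg_eq_0_iff_AE) auto
  then have "AE x in lebesgue. x \<notin> K"
    by eventually_elim (use K(2) in \<open>auto simp: S_def indicator_def split: if_splits\<close>)
  then show False
    using posK by (simp add: AE_iff_null_sets[symmetric] null_sets_def flip: AE_iff_null_sets)
qed

text \<open>The difference of two weak derivatives is orthogonal to every test function, and so is
  its negative; both are therefore nonpositive almost everywhere. Cutting off to the open interval
  alters only the two endpoints, which \<open>cis\<close> would identify.\<close>

lemma has_weak_deriv_unique:
  assumes "g1 \<in> L2T" "g2 \<in> L2T" "has_weak_deriv f g1" "has_weak_deriv f g2"
  shows "AE x in lebesgue. x \<in> {0..2 * pi} \<longrightarrow> g1 x = g2 x"
proof -
  define d where "d x = indicator {0<..<2 * pi} x * (g1 x - g2 x)" for x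
  have i: "integrable lebesgue (\<lambda>x. indicator {0..2 * pi} x * g1 x)"
     "integrable lebesgue (\<lambda>x. indicator {0..2 * pi} x * g2 x)"
    using assms(1,2)[THEN set_integrable_L2T] by (auto simp: set_integrable_def)
  have "integrable lebesgue (\<lambda>x. indicator {0<..<2 * pi} x * (indicator {0..2 * pi} x * g1 x - indicator {0..2 * pi} x * g2 x))"
    using integrable_mult_indicator[of "{0<..<2 * pi}" lebesgue, OF _ Bochner_Integration.integrable_diff[OF i]]
    by simp
  moreover have "(\<lambda>x. indicator {0<..<2 * pi} x * (indicator {0..2 * pi} x * g1 x - indicator {0..2 * pi} x * g2 x)) = d"
    by (auto simp: d_def indicator_def)
  ultimately have d: "integrable lebesgue d" by simp
  have ae: "AE x in lebesgue. x \<noteq> 0 \<and> x \<noteq> 2 * pi"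
    by (intro AE_conjI AE_completion AE_lborel_singleton)
  have test: "(LINT x|lebesgue. d x * \<phi> x) = 0" if \<phi>: "test_fun \<phi>" for \<phi>
  proof -
    have c: "continuous_on UNIV \<phi>"
      using \<phi> funpow_0 unfolding test_fun_def by (metis differentiable_imp_continuous_on)
    have ip: "integrable lebesgue (\<lambda>x. indicator {0..2 * pi} x * (g x * \<phi> x))" if "g \<in> L2T" for g
      using set_integrable_L2T_mult_continuous[OF that c] by (simp add: set_integrable_def)
    have "(LINT x|lebesgue. d x * \<phi> x) =
        (LINT x|lebesgue. indicator {0..2 * pi} x * (g1 x * \<phi> x) - indicator {0..2 * pi} x * (g2 x * \<phi> x))"
    proof (rule integral_cong_AE)
      show "AE x in lebesgue. d x * \<phi> x = indicator {0..2 * pi} x * (g1 x * \<phi> x) - indicator {0..2 * pi} x * (g2 x * \<phi> x)"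
        using ae by eventually_elim (auto simp: d_def indicator_def algebra_simps)
      show "(\<lambda>x. d x * \<phi> x) \<in> borel_measurable lebesgue"
        using d borel_measurable_lebesgueI[OF borel_measurable_continuous_onI[OF c]] by (auto intro: borel_measurable_times)
    qed (use ip[OF assms(1)] ip[OF assms(2)] in auto)
    also have "\<dots> = (LINT x:{0..2 * pi}|lebesgue. g1 x * \<phi> x) - (LINT x:{0..2 * pi}|lebesgue. g2 x * \<phi> x)"
      using ip assms by (subst Bochner_Integration.integral_diff) (auto simp: set_lebesgue_integral_def)
    also have "\<dots> = 0"
      using assms(3,4) \<phi> by (auto simp: has_weak_deriv_def)
    finally show ?thesis .
  qed
  have 1: "AE x in lebesgue. d x \<le> 0"
    by (rule test_fun_orthogonal_nonpos[OF d]) (auto simp: d_def intro: test[unfolded d_def])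
  have 2: "AE x in lebesgue. - d x \<le> 0"
    by (rule test_fun_orthogonal_nonpos[OF integrable_minus[OF d]]) (use test in \<open>auto simp: d_def\<close>)
  show ?thesis
    using 1 2 ae by eventually_elim (auto simp: d_def split: if_splits)
qed

lemma L2_norm_cong_AE:
  assumes "g1 \<in> borel_measurable lebesgue" "g2 \<in> borel_measurable lebesgue"
    "AE x in lebesgue. x \<in> {0..2 * pi} \<longrightarrow> g1 x = g2 x"
  shows "L2_norm g1 = L2_norm g2"
proof -
  have "(LINT x:{0..2 * pi}|lebesgue. (g1 x)\<^sup>2) = (LINT x:{0..2 * pi}|lebesgue. (g2 x)\<^sup>2)"
    unfolding set_lebesgue_integral_def using assms
    by (intro integral_cong_AE; measurable) (auto elim!: eventually_mono simp: indicator_def)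
  then show ?thesis by (simp add: L2_norm_def)
qed

text \<open>\<open>weak_deriv\<close> is an arbitrary choice, but its norm ignores null sets and can
  be read off from any explicit weak derivative.\<close>

lemma L2_norm_weak_deriv:
  assumes "g \<in> L2T" "has_weak_deriv f g"
  shows "L2_norm (weak_deriv f) = L2_norm g"
proof -
  have "weak_deriv f \<in> L2T \<and> has_weak_deriv f (weak_deriv f)"
    unfolding weak_deriv_def by (rule someI[of _ g]) (use assms in auto)
  then show ?thesis
    using assms has_weak_deriv_unique[of "weak_deriv f" g f]
    by (intro L2_norm_cong_AE) (auto simp: L2T_def)
qed

section \<open>Integration on boxes and test functions\<close>

lemma set_integral_lebesgue_lborel:
  fixes f :: "'a::euclidean_space \<Rightarrow> real"
  assumes "f \<in> borel_measurable borel" "A \<in> sets borel"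
  shows "(LINT x:A|lebesgue. f x) = (LINT x:A|lborel. f x)"
  unfolding set_lebesgue_integral_def using assms by (intro integral_completion) (auto intro: borel_measurable_scaleR)

lemma set_integrable_lborel_bounded:
  fixes f :: "'a::euclidean_space \<Rightarrow> real"
  assumes "f \<in> borel_measurable borel" "compact A" "\<And>x. x \<in> A \<Longrightarrow> \<bar>f x\<bar> \<le> B"
  shows "set_integrable lborel A f"
  unfolding set_integrable_def using assms
  by (intro integrableI_bounded_set_indicator[where B = B] emeasure_bounded_finite compact_imp_bounded)
     (auto simp: compact_imp_closed borel_closed)

lemma set_integrable_lebesgue_bounded:
  fixes f :: "'a::euclidean_space \<Rightarrow> real"
  assumes "f \<in> borel_measurable borel" "compact A" "\<And>x. x \<in> A \<Longrightarrow> \<bar>f x\<bar> \<le> B"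
  shows "set_integrable lebesgue A f"
proof -
  have "A \<in> sets borel" using assms by (simp add: compact_imp_closed borel_closed)
  with set_integrable_lborel_bounded[OF assms] assms(1) show ?thesis
    unfolding set_integrable_def by (subst integrable_completion) auto
qed

text \<open>Fubini is applied to the Borel product measure, because \<open>lebesgue\<close> on the
  plane is a completion rather than the product of the completed measures. For Borel integrands the
  two integrals agree, and boundedness supplies integrability.\<close>

lemma set_integral_box_iterated:
  fixes f :: "real \<times> real \<Rightarrow> real"
  assumes [measurable]: "f \<in> borel_measurable borel"
    and B: "\<And>t x. t \<in> {a..b} \<Longrightarrow> x \<in> {c..d} \<Longrightarrow> \<bar>f (t, x)\<bar> \<le> B"
  shows "(LINT p:{a..b} \<times> {c..d}|lebesgue. f p) =
           (LINT t:{a..b}|lebesgue. LINT x:{c..d}|lebesgue. f (t, x))" (is "?L = ?R1")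
    and "(LINT p:{a..b} \<times> {c..d}|lebesgue. f p) =
           (LINT x:{c..d}|lebesgue. LINT t:{a..b}|lebesgue. f (t, x))" (is "_ = ?R2")
proof -
  let ?F = "\<lambda>t x. indicat_real {a..b} t * (indicat_real {c..d} x * f (t, x))"
  have f [measurable]: "f \<in> borel_measurable (lborel \<Otimes>\<^sub>M lborel)"
    by (simp add: lborel_prod)
  have eq: "(\<lambda>p. indicator ({a..b} \<times> {c..d}) p *\<^sub>R f p) = case_prod ?F"
    by (auto simp: indicator_def)
  have "set_integrable lborel ({a..b} \<times> {c..d}) f"
    using B by (intro set_integrable_lborel_bounded[where B = B]) (auto intro: compact_Times)
  then have int: "integrable (lborel \<Otimes>\<^sub>M lborel) (case_prod ?F)"
    unfolding set_integrable_def eq by (simp add: lborel_prod)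
  have box: "{a..b} \<times> {c..d} \<in> sets (borel :: (real \<times> real) measure)"
    by (intro borel_closed closed_Times) auto
  have L: "?L = integral\<^sup>L (lborel \<Otimes>\<^sub>M lborel) (case_prod ?F)"
    using set_integral_lebesgue_lborel[OF assms(1) box]
    unfolding set_lebesgue_integral_def eq by (simp add: lborel_prod)
  have [measurable]: "(\<lambda>x. f (t, x)) \<in> borel_measurable borel" "(\<lambda>t. f (t, x)) \<in> borel_measurable borel" for t x
    by (auto intro!: measurable_compose[OF _ assms(1)] borel_measurable_continuous_onI continuous_intros)
  have m: "(\<lambda>t. LINT x:{c..d}|lborel. f (t, x)) \<in> borel_measurable borel"
    "(\<lambda>x. LINT t:{a..b}|lborel. f (t, x)) \<in> borel_measurable borel"
    unfolding set_lebesgue_integral_def by measurable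
  have "?R1 = (LINT t:{a..b}|lborel. LINT x:{c..d}|lborel. f (t, x))"
    using m by (simp add: set_integral_lebesgue_lborel)
  also have "\<dots> = (LINT t|lborel. LINT x|lborel. ?F t x)"
    by (simp add: set_lebesgue_integral_def)
  finally have R1: "?R1 = (LINT t|lborel. LINT x|lborel. ?F t x)" .
  have "?R2 = (LINT x:{c..d}|lborel. LINT t:{a..b}|lborel. f (t, x))"
    using m by (simp add: set_integral_lebesgue_lborel)
  also have "\<dots> = (LINT x|lborel. LINT t|lborel. ?F t x)"
    unfolding mult.left_commute[of "indicat_real {a..b} _"] by (simp add: set_lebesgue_integral_def)
  finally have R2: "?R2 = (LINT x|lborel. LINT t|lborel. ?F t x)" .
  show "?L = ?R1"
    using lborel_pair.integral_fst'[OF int] by (simp only: L R1) simp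
  show "?L = ?R2"
    using lborel_pair.integral_snd[OF int] by (simp only: L R2)
qed

text \<open>The gauge integral tolerates finitely many points without derivative as long as
  \<open>F\<close> is continuous; assumed integrability carries the value over to the Lebesgue
  integral.\<close>

lemma set_integral_FTC_interior_strong:
  fixes F f :: "real \<Rightarrow> real"
  assumes "finite S" "a \<le> b" "continuous_on {a..b} F"
    and "\<And>x. x \<in> {a<..<b} - S \<Longrightarrow> (F has_real_derivative f x) (at x)"
    and "set_integrable lebesgue {a..b} f"
  shows "(LINT x:{a..b}|lebesgue. f x) = F b - F a"
proof -
  have "(f has_integral F b - F a) {a..b}"
    using assms by (intro fundamental_theorem_of_calculus_interior_strong[where S = S])
      (auto simp: has_real_derivative_iff_has_vector_derivative)
  then show ?thesis
    using set_lebesgue_integral_eq_integral(2)[OF assms(5)] by (simp add: integral_unique)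
qed

lemma set_integral_by_parts_interior_strong:
  fixes F f G g :: "real \<Rightarrow> real"
  assumes fin: "finite S" "a \<le> b" and F: "continuous_on UNIV F"
    and f: "f \<in> borel_measurable borel" "\<And>x. x \<in> {a..b} \<Longrightarrow> \<bar>f x\<bar> \<le> B"
    and der: "\<And>x. x \<in> {a<..<b} - S \<Longrightarrow> (F has_real_derivative f x) (at x)"
    and G: "\<And>x. (G has_real_derivative g x) (at x)" and g: "continuous_on UNIV g"
  shows "(LINT x:{a..b}|lebesgue. F x * g x) =
    F b * G b - F a * G a - (LINT x:{a..b}|lebesgue. f x * G x)"
proof -
  have cG: "continuous_on UNIV G"
    using G DERIV_isCont by (auto simp: continuous_on_eq_continuous_at)
  have ex: "\<exists>C. \<forall>x\<in>{a..b}. \<bar>h x\<bar> \<le> C" if "continuous_on UNIV h" for h :: "real \<Rightarrow> real"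
    using compact_imp_bounded[OF compact_continuous_image[OF continuous_on_subset[OF that] compact_Icc[of a b]]]
    by (force simp: bounded_iff)
  note [measurable] = f(1) borel_measurable_continuous_onI[OF F] borel_measurable_continuous_onI[OF g]
    borel_measurable_continuous_onI[OF cG]
  obtain C where C: "\<forall>x\<in>{a..b}. \<bar>F x * g x\<bar> \<le> C" using ex[OF continuous_on_mult[OF F g]] by auto
  obtain D where D: "\<forall>x\<in>{a..b}. \<bar>G x\<bar> \<le> D" using ex[OF cG] by auto
  have i1: "set_integrable lebesgue {a..b} (\<lambda>x. F x * g x)"
    using C by (intro set_integrable_lebesgue_bounded[where B = C]) auto
  have "\<bar>f x * G x\<bar> \<le> \<bar>B\<bar> * \<bar>D\<bar>" if "x \<in> {a..b}" for x
    using f(2)[OF that] bspec[OF D that] unfolding abs_mult by (intro mult_mono) linarith+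
  then have i2: "set_integrable lebesgue {a..b} (\<lambda>x. f x * G x)"
    by (intro set_integrable_lebesgue_bounded[where B = "\<bar>B\<bar> * \<bar>D\<bar>"]) auto
  have "(LINT x:{a..b}|lebesgue. F x * g x + f x * G x) = F b * G b - F a * G a"
    by (rule set_integral_FTC_interior_strong[OF fin, where F = "\<lambda>x. F x * G x"])
       (auto intro!: derivative_eq_intros der G continuous_on_mult continuous_on_subset[OF F]
          continuous_on_subset[OF cG] set_integral_add i1 i2 simp: mult.commute[of "G _"])
  then show ?thesis by (simp add: set_integral_add(2)[OF i1 i2])
qed

section \<open>Periodic functions and integrals over one period\<close>

lemma periodic_add_int:
  assumes "periodic g"
  shows "g (x + 2 * pi * of_int k) = g x"
proof -
  have "g (x + 2 * pi * real n) = g x" for n x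
  proof (induction n)
    case (Suc n)
    have "x + 2 * pi * real (Suc n) = (x + 2 * pi * real n) + 2 * pi" by (simp add: algebra_simps)
    with Suc assms show ?case by (metis periodic_def)
  qed simp
  from this[of x "nat k"] this[of "x + 2 * pi * of_int k" "nat (- k)"] show ?thesis
    by (cases "k \<ge> 0") (auto simp: algebra_simps)
qed

lemma two_pi_reduce:
  obtains r k where "r \<in> {0..<2 * pi}" "x = r + 2 * pi * of_int k"
proof
  show "x - 2 * pi * of_int \<lfloor>x / (2 * pi)\<rfloor> \<in> {0..<2 * pi}"
    using floor_divide_lower[of "2 * pi" x] floor_divide_upper[of "2 * pi" x]
    by (auto simp: algebra_simps)
qed simp

lemma periodic_bounded:
  assumes "periodic g" "\<And>x. x \<in> {0..2 * pi} \<Longrightarrow> \<bar>g x\<bar> \<le> B"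
  shows "\<bar>g x\<bar> \<le> B"
  using assms two_pi_reduce[of x] periodic_add_int[OF assms(1)]
  by (metis atLeastAtMost_iff atLeastLessThan_iff less_imp_le)

text \<open>Modulo whole periods the shift is some \<open>r\<close> in one period. The window
  \<open>{r..2 * pi + r}\<close> is cut at \<open>2 * pi\<close> and its second piece moved back by
  one period.\<close>

lemma periodic_set_integral_shift:
  fixes g :: "real \<Rightarrow> real"
  assumes g: "periodic g" "g \<in> borel_measurable borel" "\<And>x. x \<in> {0..2 * pi} \<Longrightarrow> \<bar>g x\<bar> \<le> B"
  shows "(LINT x:{0..2 * pi}|lebesgue. g (x + s)) = (LINT x:{0..2 * pi}|lebesgue. g x)"
proof -
  have B: "\<bar>g x\<bar> \<le> B" for x using periodic_bounded[OF g(1,3)] .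
  have int: "set_integrable lebesgue {a..b} (\<lambda>x. g (x + s))" for a b s
    using B g(2) by (intro set_integrable_lebesgue_bounded[where B = B]) auto
  have io: "g integrable_on {a..b}" for a b
    using set_lebesgue_integral_eq_integral(1)[OF int[of a b 0]] by simp
  obtain r k where r: "r \<in> {0..<2 * pi}" and s: "s = r + 2 * pi * of_int k"
    by (rule two_pi_reduce)
  have sh: "integral {a..b} (\<lambda>x. g (x + c)) = integral {a + c..b + c} g" for a b c
    using integral_shift_Icc_real[of a b g c] by (simp add: o_def add.commute)
  have "(LINT x:{0..2 * pi}|lebesgue. g (x + s)) = integral {0..2 * pi} (\<lambda>x. g (x + s))"
    by (rule set_lebesgue_integral_eq_integral(2)[OF int])
  also have "integral {0..2 * pi} (\<lambda>x. g (x + s)) = integral {0..2 * pi} (\<lambda>x. g (x + r))"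
    using periodic_add_int[OF g(1), of "_ + r" k] by (simp add: s add.assoc)
  also have "integral {0..2 * pi} (\<lambda>x. g (x + r)) = integral {r..2 * pi + r} g"
    by (simp add: sh)
  also have "\<dots> = integral {r..2 * pi} g + integral {2 * pi..2 * pi + r} g"
    using r by (intro Henstock_Kurzweil_Integration.integral_combine[symmetric] io) auto
  also have "integral {2 * pi..2 * pi + r} g = integral {0..r} g"
    using sh[of 0 r "2 * pi"] g(1) by (simp add: periodic_def add.commute)
  also have "integral {r..2 * pi} g + integral {0..r} g = integral {0..2 * pi} g"
    using r by (subst add.commute, intro Henstock_Kurzweil_Integration.integral_combine io) auto
  also have "\<dots> = (LINT x:{0..2 * pi}|lebesgue. g x)"
    using set_lebesgue_integral_eq_integral(2)[OF int[of 0 "2 * pi" 0]] by simp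
  finally show ?thesis .
qed

lemma bounded_borel_L2T:
  assumes "periodic f" "f \<in> borel_measurable borel" "\<And>x. x \<in> {0..2 * pi} \<Longrightarrow> \<bar>f x\<bar> \<le> B"
  shows "f \<in> L2T"
proof -
  have "(f x)\<^sup>2 \<le> B\<^sup>2" if "x \<in> {0..2 * pi}" for x
    using power_mono[OF assms(3)[OF that] abs_ge_zero, of 2] by simp
  with assms show ?thesis
    by (auto simp: L2T_def borel_measurable_lebesgueI intro!: set_integrable_lebesgue_bounded[where B = "B\<^sup>2"])
qed

text \<open>Dominated convergence along sequences of times. Continuity at the given \<open>t\<close>
  for almost every \<open>x\<close> is all that a travelling wave with jumps can offer, and it
  suffices.\<close>

lemma L2_norm_diff_tendsto_0:
  fixes w :: "real \<Rightarrow> real \<Rightarrow> real"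
  assumes w: "\<And>s. w s \<in> borel_measurable borel" and B: "\<And>s x. \<bar>w s x\<bar> \<le> B"
    and lim: "AE x in lebesgue. isCont (\<lambda>s. w s x) t"
  shows "((\<lambda>s. L2_norm (\<lambda>x. w s x - w t x)) \<longlongrightarrow> 0) (at t within A)"
  unfolding tendsto_at_iff_sequentially comp_def
proof (intro allI impI)
  fix X :: "nat \<Rightarrow> real" assume X: "X \<longlonglongrightarrow> t"
  have [measurable]: "w s \<in> borel_measurable lebesgue" for s
    by (rule borel_measurable_lebesgueI[OF w])
  have "(\<lambda>n. LINT x|lebesgue. indicator {0..2 * pi} x *\<^sub>R (w (X n) x - w t x)\<^sup>2)
      \<longlonglongrightarrow> (LINT x::real|lebesgue. 0)"
  proof (rule integral_dominated_convergence)
    show "integrable lebesgue (\<lambda>x. indicator {0..2 * pi} x *\<^sub>R (2 * B)\<^sup>2)"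
      using set_integrable_lebesgue_bounded[of "\<lambda>_. (2 * B)\<^sup>2" "{0..2 * pi}" "(2 * B)\<^sup>2"]
      by (simp add: set_integrable_def)
    show "AE x in lebesgue. (\<lambda>n. indicator {0..2 * pi} x *\<^sub>R (w (X n) x - w t x)\<^sup>2) \<longlonglongrightarrow> 0"
      using lim
    proof eventually_elim
      case (elim x)
      have "(\<lambda>n. w (X n) x) \<longlonglongrightarrow> w t x"
        using isCont_tendsto_compose[OF elim X] .
      then have "(\<lambda>n. indicator {0..2 * pi} x *\<^sub>R (w (X n) x - w t x)\<^sup>2)
          \<longlonglongrightarrow> indicator {0..2 * pi} x *\<^sub>R (w t x - w t x)\<^sup>2"
        by (intro tendsto_intros)
      then show ?case by simp
    qed
    show "AE x in lebesgue. norm (indicator {0..2 * pi} x *\<^sub>R (w (X n) x - w t x)\<^sup>2)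
        \<le> indicator {0..2 * pi} x *\<^sub>R (2 * B)\<^sup>2" for n
    proof (rule AE_I2)
      fix x
      have "\<bar>w (X n) x - w t x\<bar> \<le> 2 * B"
        using B[of "X n" x] B[of t x] by linarith
      then have "(w (X n) x - w t x)\<^sup>2 \<le> (2 * B)\<^sup>2"
        using power_mono[of "\<bar>w (X n) x - w t x\<bar>" "2 * B" 2] by simp
      then show "norm (indicator {0..2 * pi} x *\<^sub>R (w (X n) x - w t x)\<^sup>2) \<le> indicator {0..2 * pi} x *\<^sub>R (2 * B)\<^sup>2"
        by (auto simp: indicator_def)
    qed
  qed (auto intro!: borel_measurable_times)
  then have "(\<lambda>n. LINT x:{0..2 * pi}|lebesgue. (w (X n) x - w t x)\<^sup>2) \<longlonglongrightarrow> 0"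
    by (simp add: set_lebesgue_integral_def)
  from tendsto_real_sqrt[OF this] show "(\<lambda>n. L2_norm (\<lambda>x. w (X n) x - w t x)) \<longlonglongrightarrow> 0"
    by (simp add: L2_norm_def)
qed

section \<open>Calculus of space-time test functions\<close>

lemma curried_chain_rule:
  fixes \<phi> :: "real \<Rightarrow> real \<Rightarrow> real"
  assumes diff: "(\<lambda>(t, x). \<phi> t x) differentiable at (\<alpha> s, \<beta> s)"
    and \<alpha>: "(\<alpha> has_real_derivative a) (at s)" and \<beta>: "(\<beta> has_real_derivative b) (at s)"
  shows "((\<lambda>s. \<phi> (\<alpha> s) (\<beta> s)) has_real_derivative
    a * dt \<phi> (\<alpha> s) (\<beta> s) + b * dx \<phi> (\<alpha> s) (\<beta> s)) (at s)"
proof -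
  obtain D where D: "((\<lambda>(t, x). \<phi> t x) has_derivative D) (at (\<alpha> s, \<beta> s))"
    using diff by (auto simp: differentiable_def)
  interpret D: bounded_linear D by (rule has_derivative_bounded_linear[OF D])
  \<comment> \<open>Stated for any curve through the point, so that it serves three times: along the
    given curve, and along both coordinate lines, where it identifies \<open>dt \<phi>\<close> and
    \<open>dx \<phi>\<close> with the values of \<open>D\<close> on the basis vectors.\<close>
  have chain: "((\<lambda>r. \<phi> (\<gamma> r) (\<delta> r)) has_real_derivative c * D (1, 0) + d * D (0, 1)) (at u)"
    if \<gamma>: "(\<gamma> has_real_derivative c) (at u)" and \<delta>: "(\<delta> has_real_derivative d) (at u)"
      and eq: "\<gamma> u = \<alpha> s" "\<delta> u = \<beta> s" for \<gamma> \<delta> c d u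
  proof -
    have pair: "((\<lambda>r. (\<gamma> r, \<delta> r)) has_derivative (\<lambda>h. (c * h, d * h))) (at u)"
      using \<gamma> \<delta> unfolding has_field_derivative_def by (rule has_derivative_Pair)
    have "((\<lambda>r. (\<lambda>(t, x). \<phi> t x) (\<gamma> r, \<delta> r)) has_derivative (\<lambda>h. D (c * h, d * h))) (at u)"
      by (rule has_derivative_compose[OF pair]) (simp add: D eq)
    moreover have "D (c * h, d * h) = (c * D (1, 0) + d * D (0, 1)) * h" for h
      using D.add[of "(c * h) *\<^sub>R (1, 0)" "(d * h) *\<^sub>R (0, 1)"]
        D.scaleR[of "c * h" "(1, 0)"] D.scaleR[of "d * h" "(0, 1)"]
      by (simp add: algebra_simps)
    ultimately show ?thesis by (simp add: has_field_derivative_def)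
  qed
  have "dt \<phi> (\<alpha> s) (\<beta> s) = D (1, 0)"
    unfolding dt_def using chain[OF DERIV_ident DERIV_const] by (simp add: DERIV_imp_deriv)
  moreover have "dx \<phi> (\<alpha> s) (\<beta> s) = D (0, 1)"
    unfolding dx_def using chain[OF DERIV_const DERIV_ident] by (simp add: DERIV_imp_deriv)
  ultimately show ?thesis using chain[OF \<alpha> \<beta>] by simp
qed

lemma iter_partial_append: "iter_partial bs (iter_partial cs \<phi>) = iter_partial (bs @ cs) \<phi>"
  by (induction bs) auto

lemma test_fun2_differentiable:
  assumes "test_fun2 T \<phi>"
  shows "(\<lambda>(t, x). iter_partial bs \<phi> t x) differentiable at p"
  using assms unfolding test_fun2_def differentiable_on_def by blast

lemma test_fun2_continuous:
  assumes "test_fun2 T \<phi>"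
  shows "continuous_on UNIV (\<lambda>p. iter_partial bs \<phi> (fst p) (snd p))"
  using assms differentiable_imp_continuous_on[of "\<lambda>(t, x). iter_partial bs \<phi> t x" UNIV]
  by (auto simp: test_fun2_def case_prod_beta)

lemma test_fun2_has_dt:
  assumes "test_fun2 T \<phi>"
  shows "((\<lambda>s. iter_partial bs \<phi> s x) has_real_derivative dt (iter_partial bs \<phi>) t x) (at t)"
  using curried_chain_rule[OF test_fun2_differentiable[OF assms] DERIV_ident DERIV_const] by simp

lemma test_fun2_has_dx:
  assumes "test_fun2 T \<phi>"
  shows "(iter_partial bs \<phi> t has_real_derivative dx (iter_partial bs \<phi>) t x) (at x)"
  using curried_chain_rule[OF test_fun2_differentiable[OF assms] DERIV_const DERIV_ident] by simp

lemma test_fun2_periodic: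
  assumes "test_fun2 T \<phi>"
  shows "periodic (iter_partial bs \<phi> t)"
proof (induction bs arbitrary: t)
  case (Cons b bs)
  have per: "iter_partial bs \<phi> t (x + 2 * pi) = iter_partial bs \<phi> t x" for t x
    using Cons.IH by (simp add: periodic_def)
  have "dx (iter_partial bs \<phi>) t (x + 2 * pi) = dx (iter_partial bs \<phi>) t x" for x
  proof -
    have "((\<lambda>y. iter_partial bs \<phi> t (y + 2 * pi)) has_real_derivative dx (iter_partial bs \<phi>) t (x + 2 * pi)) (at x)"
      by (subst DERIV_shift[symmetric]) (rule test_fun2_has_dx[OF assms])
    then have "(iter_partial bs \<phi> t has_real_derivative dx (iter_partial bs \<phi>) t (x + 2 * pi)) (at x)"
      by (simp add: per)
    then show ?thesis using test_fun2_has_dx[OF assms] DERIV_unique by blast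
  qed
  then show ?case by (auto simp: periodic_def dt_def per)
qed (use assms in \<open>simp add: test_fun2_def\<close>)

text \<open>Makes \<open>dt \<phi>\<close> available as a test function, so that the second time
  derivative can be treated by the rule for the first. The support survives because the complement
  of \<open>{a..b}\<close> is open.\<close>

lemma test_fun2_dt:
  assumes "test_fun2 T \<phi>"
  shows "test_fun2 T (dt \<phi>)"
proof -
  obtain a b where ab: "0 < a" "b < T" "\<And>t x. t \<notin> {a..b} \<Longrightarrow> \<phi> t x = 0"
    using assms by (auto simp: test_fun2_def)
  have "dt \<phi> t x = 0" if t: "t \<notin> {a..b}" for t x
  proof -
    have "((\<lambda>s. \<phi> s x) has_real_derivative 0) (at t)"
      by (rule has_field_derivative_transform_within_open[of "\<lambda>_. 0" _ _ "- {a..b}"])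
         (use t ab in auto)
    then show ?thesis by (simp add: dt_def DERIV_imp_deriv)
  qed
  moreover have "iter_partial bs (dt \<phi>) = iter_partial (bs @ [True]) \<phi>" for bs
    using iter_partial_append[of bs "[True]" \<phi>] by simp
  moreover have "periodic (dt \<phi> t)" for t
    using test_fun2_periodic[OF assms, of "[True]"] by simp
  moreover have "(\<lambda>(t, x). iter_partial bs \<phi> t x) differentiable_on UNIV" for bs
    using assms by (simp add: test_fun2_def)
  ultimately show ?thesis
    using ab(1,2) by (simp only: test_fun2_def) blast
qed

section \<open>Superpositions of travelling profiles\<close>

lemma test_fun_has_deriv:
  assumes "test_fun \<phi>"
  shows "(\<phi> has_real_derivative deriv \<phi> x) (at x)" and "continuous_on UNIV (deriv \<phi>)"
    and "periodic \<phi>"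
proof -
  have d: "(deriv ^^ n) \<phi> differentiable_on UNIV" for n
    using assms by (simp add: test_fun_def)
  show "(\<phi> has_real_derivative deriv \<phi> x) (at x)"
    using d[of 0] DERIV_deriv_iff_real_differentiable by (auto simp: differentiable_on_def)
  show "continuous_on UNIV (deriv \<phi>)"
    using differentiable_imp_continuous_on[OF d[of 1]] by simp
  show "periodic \<phi>" using assms by (simp add: test_fun_def)
qed

section \<open>Linearity of pairings and weak derivatives\<close>

lemma pairing_diff_right:
  assumes "set_integrable lebesgue ({0..T} \<times> {0..2 * pi}) (\<lambda>(t, x). u t x * \<phi> t x)"
    and "set_integrable lebesgue ({0..T} \<times> {0..2 * pi}) (\<lambda>(t, x). u t x * \<psi> t x)"
  shows "pairing T u (\<lambda>t x. \<phi> t x - \<psi> t x) = pairing T u \<phi> - pairing T u \<psi>"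
  using set_integral_diff(2)[OF assms] by (simp add: pairing_def case_prod_unfold right_diff_distrib)

lemma pairing_mult_right: "pairing T u (\<lambda>t x. c * \<phi> t x) = c * pairing T u \<phi>"
  unfolding pairing_def
  by (subst set_integral_mult_right[symmetric]) (simp add: case_prod_unfold mult.left_commute)

lemma pairing_diff_left:
  assumes "set_integrable lebesgue ({0..T} \<times> {0..2 * pi}) (\<lambda>(t, x). u t x * \<phi> t x)"
    and "set_integrable lebesgue ({0..T} \<times> {0..2 * pi}) (\<lambda>(t, x). v t x * \<phi> t x)"
  shows "pairing T (\<lambda>t x. u t x - v t x) \<phi> = pairing T u \<phi> - pairing T v \<phi>"
  using set_integral_diff(2)[OF assms] by (simp add: pairing_def case_prod_unfold left_diff_distrib)

lemma pairing_add_left: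
  assumes "set_integrable lebesgue ({0..T} \<times> {0..2 * pi}) (\<lambda>(t, x). u t x * \<phi> t x)"
    and "set_integrable lebesgue ({0..T} \<times> {0..2 * pi}) (\<lambda>(t, x). v t x * \<phi> t x)"
  shows "pairing T (\<lambda>t x. u t x + v t x) \<phi> = pairing T u \<phi> + pairing T v \<phi>"
  using set_integral_add(2)[OF assms] by (simp add: pairing_def case_prod_unfold distrib_right)

lemma
  assumes L2T: "f1 \<in> L2T" "f2 \<in> L2T" "g1 \<in> L2T" "g2 \<in> L2T"
    and weak: "has_weak_deriv f1 g1" "has_weak_deriv f2 g2"
  shows has_weak_deriv_add: "has_weak_deriv (\<lambda>x. f1 x + f2 x) (\<lambda>x. g1 x + g2 x)"
    and has_weak_deriv_diff: "has_weak_deriv (\<lambda>x. f1 x - f2 x) (\<lambda>x. g1 x - g2 x)"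
proof -
  have "(LINT x:{0..2 * pi}|lebesgue. (f1 x + f2 x) * deriv \<phi> x) = - (LINT x:{0..2 * pi}|lebesgue. (g1 x + g2 x) * \<phi> x)"
    "(LINT x:{0..2 * pi}|lebesgue. (f1 x - f2 x) * deriv \<phi> x) = - (LINT x:{0..2 * pi}|lebesgue. (g1 x - g2 x) * \<phi> x)"
    if "test_fun \<phi>" for \<phi>
  proof -
    have c: "continuous_on UNIV \<phi>" "continuous_on UNIV (deriv \<phi>)"
      using DERIV_isCont[OF test_fun_has_deriv(1)[OF that]] test_fun_has_deriv(2)[OF that]
      by (auto intro: continuous_at_imp_continuous_on)
    note i = set_integrable_L2T_mult_continuous[OF L2T(1) c(2)] set_integrable_L2T_mult_continuous[OF L2T(2) c(2)]
      set_integrable_L2T_mult_continuous[OF L2T(3) c(1)] set_integrable_L2T_mult_continuous[OF L2T(4) c(1)]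
    have eq: "(LINT x:{0..2 * pi}|lebesgue. f1 x * deriv \<phi> x) = - (LINT x:{0..2 * pi}|lebesgue. g1 x * \<phi> x)"
      "(LINT x:{0..2 * pi}|lebesgue. f2 x * deriv \<phi> x) = - (LINT x:{0..2 * pi}|lebesgue. g2 x * \<phi> x)"
      using weak that by (auto simp: has_weak_deriv_def)
    show "(LINT x:{0..2 * pi}|lebesgue. (f1 x + f2 x) * deriv \<phi> x) = - (LINT x:{0..2 * pi}|lebesgue. (g1 x + g2 x) * \<phi> x)"
      unfolding distrib_right set_integral_add(2)[OF i(1,2)] set_integral_add(2)[OF i(3,4)] eq by simp
    show "(LINT x:{0..2 * pi}|lebesgue. (f1 x - f2 x) * deriv \<phi> x) = - (LINT x:{0..2 * pi}|lebesgue. (g1 x - g2 x) * \<phi> x)"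
      unfolding left_diff_distrib set_integral_diff(2)[OF i(1,2)] set_integral_diff(2)[OF i(3,4)] eq by simp
  qed
  then show "has_weak_deriv (\<lambda>x. f1 x + f2 x) (\<lambda>x. g1 x + g2 x)"
    "has_weak_deriv (\<lambda>x. f1 x - f2 x) (\<lambda>x. g1 x - g2 x)"
    by (auto simp: has_weak_deriv_def)
qed

lemma continuous_bounded_box:
  fixes f :: "real \<times> real \<Rightarrow> real"
  assumes "continuous_on UNIV f"
  obtains B where "\<And>t x. t \<in> {a..b} \<Longrightarrow> x \<in> {c..d} \<Longrightarrow> \<bar>f (t, x)\<bar> \<le> B"
proof -
  have "compact (f ` ({a..b} \<times> {c..d}))"
    by (intro compact_continuous_image continuous_on_subset[OF assms] compact_Times compact_Icc) auto
  then show ?thesis using that compact_imp_bounded by (fastforce simp: bounded_iff)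
qed

text \<open>A piecewise continuously differentiable profile with corners in a locally finite set
  \<open>S\<close>. Local finiteness serves integration by parts, continuity of \<open>U'\<close>
  off \<open>S\<close> serves continuity in time of the norms, and a common bound \<open>B\<close>
  serves domination.\<close>

locale travelling_profile =
  fixes U U' :: "real \<Rightarrow> real" and S :: "real set" and B :: real
  assumes per: "periodic U" "periodic U'"
    and cont: "continuous_on UNIV U"
    and borel': "U' \<in> borel_measurable borel"
    and bnd: "\<And>x. \<bar>U x\<bar> \<le> B" and bnd': "\<And>x. \<bar>U' x\<bar> \<le> B"
    and fin: "\<And>a b. finite (S \<inter> {a..b})"
    and deriv: "\<And>x. x \<notin> S \<Longrightarrow> (U has_real_derivative U' x) (at x)"
    and cont': "\<And>x. x \<notin> S \<Longrightarrow> isCont U' x"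
begin

lemma borel: "U \<in> borel_measurable borel"
  by (rule borel_measurable_continuous_onI[OF cont])

lemma borel_comp [measurable]:
  assumes [measurable]: "g \<in> borel_measurable M"
  shows "(\<lambda>p. U (g p)) \<in> borel_measurable M" "(\<lambda>p. U' (g p)) \<in> borel_measurable M"
  using measurable_compose[OF assms borel] measurable_compose[OF assms borel'] by auto

lemma per_shift: "periodic (\<lambda>x. U (x + s))" "periodic (\<lambda>x. U' (x + s))"
  using per by (simp_all add: periodic_def add.commute[of _ s] add.assoc[symmetric])

text \<open>A locally finite set is a countable union of finite sets, so it and all its translates
  are null.\<close>

lemma AE_regular: "AE x in lebesgue. x + s \<notin> S"
proof -
  have "countable (\<Union>n::nat. S \<inter> {- real n..real n})"
    by (rule countable_UN[OF countableI_type]) (rule countable_finite[OF fin])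
  moreover have "S \<subseteq> (\<Union>n::nat. S \<inter> {- real n..real n})"
  proof
    fix x assume "x \<in> S"
    moreover obtain n :: nat where "\<bar>x\<bar> \<le> real n" using real_arch_simple by blast
    ultimately show "x \<in> (\<Union>n::nat. S \<inter> {- real n..real n})" by (auto intro!: exI[of _ n])
  qed
  ultimately have "countable S" by (rule countable_subset[rotated])
  then have "countable ((\<lambda>y. y - s) ` S)" by simp
  then have "AE x in lborel. x \<notin> (\<lambda>y. y - s) ` S"
    by (intro AE_not_in countable_imp_null_set_lborel)
  then have "AE x in lebesgue. x \<notin> (\<lambda>y. y - s) ` S" by (rule AE_completion)
  then show ?thesis by eventually_elim force
qed

text \<open>The boundary terms at the two ends of the period cancel by periodicity.\<close>

lemma integral_by_parts_space:
  assumes "\<And>x. (G has_real_derivative g x) (at x)" "continuous_on UNIV g" "periodic G"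
  shows "(LINT x:{0..2 * pi}|lebesgue. U (x + s) * g x) = - (LINT x:{0..2 * pi}|lebesgue. U' (x + s) * G x)"
proof -
  have fin': "finite {x \<in> {0..2 * pi}. x + s \<in> S}"
  proof (rule finite_subset)
    show "{x \<in> {0..2 * pi}. x + s \<in> S} \<subseteq> (\<lambda>y. y - s) ` (S \<inter> {s..2 * pi + s})" by force
  qed (use fin in auto)
  have "U (2 * pi + s) = U s" "G (2 * pi) = G 0"
    using per(1)[unfolded periodic_def, rule_format, of s]
      assms(3)[unfolded periodic_def, rule_format, of 0] by (simp_all add: add.commute)
  moreover have "(LINT x:{0..2 * pi}|lebesgue. U (x + s) * g x) = U (2 * pi + s) * G (2 * pi) - U (0 + s) * G 0
      - (LINT x:{0..2 * pi}|lebesgue. U' (x + s) * G x)"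
  proof (rule set_integral_by_parts_interior_strong[OF fin' _ _ _ _ _ assms(1,2)])
    show "((\<lambda>x. U (x + s)) has_real_derivative U' (x + s)) (at x)"
      if "x \<in> {0<..<2 * pi} - {x \<in> {0..2 * pi}. x + s \<in> S}" for x
      using deriv[of "x + s"] that by (auto simp: DERIV_shift)
  qed (use bnd' in \<open>auto intro!: continuous_on_compose2[OF cont] continuous_intros\<close>)
  ultimately show ?thesis by simp
qed

text \<open>The boundary terms vanish with \<open>G\<close> at both ends. Writing the speed as
  \<open>c\<close> with square 1 treats both directions of travel at once; \<open>c\<close> is then
  its own inverse, so the times at which a corner passes \<open>x\<close> are
  \<open>c * (y - x)\<close> with \<open>y\<close> in \<open>S\<close>.\<close>

lemma integral_by_parts_time:
  assumes "\<And>t. (G has_real_derivative g t) (at t)" "continuous_on UNIV g" "G 0 = 0" "G T = 0" "0 \<le> T"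
    and c: "c\<^sup>2 = 1"
  shows "(LINT t:{0..T}|lebesgue. U (x + c * t) * g t) = - (LINT t:{0..T}|lebesgue. c * U' (x + c * t) * G t)"
proof -
  have cc: "c * (c * t) = t" for t using c by (simp add: power2_eq_square flip: mult.assoc)
  have c1: "\<bar>c\<bar> = 1" using c by (metis abs_square_eq_1 power2_abs)
  have fin': "finite {t \<in> {0..T}. x + c * t \<in> S}"
  proof (rule finite_subset)
    have "t \<in> (\<lambda>y. c * (y - x)) ` (S \<inter> {x - T..x + T})" if "t \<in> {0..T}" "x + c * t \<in> S" for t
    proof (rule image_eqI[of _ _ "x + c * t"])
      have "\<bar>c * t\<bar> \<le> T" using that c1 by (simp add: abs_mult)
      then show "x + c * t \<in> S \<inter> {x - T..x + T}" using that by auto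
    qed (simp add: cc)
    then show "{t \<in> {0..T}. x + c * t \<in> S} \<subseteq> (\<lambda>y. c * (y - x)) ` (S \<inter> {x - T..x + T})" by auto
  qed (use fin in auto)
  have "(LINT t:{0..T}|lebesgue. U (x + c * t) * g t) = U (x + c * T) * G T - U (x + c * 0) * G 0
      - (LINT t:{0..T}|lebesgue. c * U' (x + c * t) * G t)"
  proof (rule set_integral_by_parts_interior_strong[OF fin' \<open>0 \<le> T\<close> _ _ _ _ assms(1,2)])
    show "((\<lambda>t. U (x + c * t)) has_real_derivative c * U' (x + c * t)) (at t)"
      if "t \<in> {0<..<T} - {t \<in> {0..T}. x + c * t \<in> S}" for t
    proof -
      have "((\<lambda>t. x + c * t) has_real_derivative c) (at t)"
        by (auto intro!: derivative_eq_intros)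
      moreover have "(U has_real_derivative U' (x + c * t)) (at (x + c * t))"
        using that by (intro deriv) auto
      ultimately show ?thesis
        using DERIV_chain'[of "\<lambda>t. x + c * t" c t UNIV U] by (simp add: mult.commute[of c])
    qed
  qed (use bnd' c1 in \<open>auto intro!: continuous_on_compose2[OF cont] continuous_intros simp: abs_mult\<close>)
  then show ?thesis using assms by simp
qed

lemma has_weak_deriv_shift: "has_weak_deriv (\<lambda>x. U (x + s)) (\<lambda>x. U' (x + s))"
  unfolding has_weak_deriv_def using integral_by_parts_space test_fun_has_deriv by blast

text \<open>Along the characteristic \<open>x + c t = y\<close> the factor \<open>U'\<close> is constant and
  \<open>\<partial>\<^sub>t \<phi> - c \<partial>\<^sub>x \<phi>\<close> is the derivative of \<open>t \<mapsto> \<phi> t (y - c t)\<close>.\<close>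

lemma transport:
  assumes \<phi>: "test_fun2 T \<phi>" and T: "0 \<le> T"
  shows "(LINT t:{0..T}|lebesgue. LINT x:{0..2 * pi}|lebesgue.
    U' (x + c * t) * (dt \<phi> t x - c * dx \<phi> t x)) = 0"
proof -
  let ?\<psi> = "\<lambda>t x. dt \<phi> t x - c * dx \<phi> t x"
  have cd: "continuous_on UNIV (\<lambda>p. dt \<phi> (fst p) (snd p))" "continuous_on UNIV (\<lambda>p. dx \<phi> (fst p) (snd p))"
    using test_fun2_continuous[OF \<phi>, of "[True]"] test_fun2_continuous[OF \<phi>, of "[False]"] by simp_all
  have cont_\<psi>: "continuous_on A (\<lambda>p. ?\<psi> (f p) (g p))"
    if "continuous_on A f" "continuous_on A g" for A :: "'b::topological_space set" and f g
    using that continuous_on_compose2[OF cd(1), of A "\<lambda>p. (f p, g p)"]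
      continuous_on_compose2[OF cd(2), of A "\<lambda>p. (f p, g p)"]
    by (auto intro!: continuous_intros)
  \<comment> \<open>The substitution \<open>y = x + c * t\<close> straightens the characteristics:
    \<open>U' y\<close> no longer depends on time and, after exchanging the integrals, leaves the
    inner one as a constant factor. Periodicity keeps the domain \<open>{0..2 * pi}\<close>.\<close>
  have shift: "(LINT x:{0..2 * pi}|lebesgue. U' (x + c * t) * ?\<psi> t x)
      = (LINT y:{0..2 * pi}|lebesgue. U' y * ?\<psi> t (y - c * t))" for t
  proof -
    have per\<psi>: "periodic (\<lambda>y. U' y * ?\<psi> t (y - c * t))"
      using per(2) test_fun2_periodic[OF \<phi>, of "[True]" t] test_fun2_periodic[OF \<phi>, of "[False]" t]
      by (simp add: periodic_def diff_add_eq[symmetric])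
    have cy: "continuous_on UNIV (\<lambda>y. ?\<psi> t (y - c * t))"
      by (intro cont_\<psi> continuous_intros)
    obtain C where C: "\<And>y. y \<in> {0..2 * pi} \<Longrightarrow> \<bar>?\<psi> t (y - c * t)\<bar> \<le> C"
      using compact_imp_bounded[OF compact_continuous_image[OF continuous_on_subset[OF cy] compact_Icc[of 0 "2 * pi"]]]
      by (force simp: bounded_iff)
    have "\<bar>U' y * ?\<psi> t (y - c * t)\<bar> \<le> B * C" if "y \<in> {0..2 * pi}" for y
      unfolding abs_mult using bnd'[of y] C[OF that] by (intro mult_mono) auto
    from periodic_set_integral_shift[OF per\<psi> _ this, of "c * t"] show ?thesis
      using borel_measurable_continuous_onI[OF cy] borel' by (simp add: borel_measurable_times)
  qed
  let ?F = "\<lambda>p. U' (snd p) * ?\<psi> (fst p) (snd p - c * fst p)"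
  have cF: "continuous_on UNIV (\<lambda>p. ?\<psi> (fst p) (snd p - c * fst p))"
    by (intro cont_\<psi> continuous_intros)
  obtain C where C: "\<And>t x. t \<in> {0..T} \<Longrightarrow> x \<in> {0..2 * pi} \<Longrightarrow> \<bar>?\<psi> t (x - c * t)\<bar> \<le> C"
    using continuous_bounded_box[OF cF, of 0 T 0 "2 * pi"] by auto
  have F: "?F \<in> borel_measurable borel"
    using borel_measurable_continuous_onI[OF cF]
    by (intro borel_measurable_times borel_comp borel_measurable_continuous_onI[of snd] continuous_intros)
  have FB: "\<bar>?F (t, x)\<bar> \<le> B * C" if "t \<in> {0..T}" "x \<in> {0..2 * pi}" for t x
    using bnd'[of x] C[OF that] by (auto simp: abs_mult intro!: mult_mono)
  have inner: "(LINT t:{0..T}|lebesgue. U' y * ?\<psi> t (y - c * t)) = 0" for y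
  proof -
    have ct: "continuous_on UNIV (\<lambda>t. ?\<psi> t (y - c * t))"
      by (intro cont_\<psi> continuous_intros)
    obtain D where D: "\<And>t. t \<in> {0..T} \<Longrightarrow> \<bar>?\<psi> t (y - c * t)\<bar> \<le> D"
      using compact_imp_bounded[OF compact_continuous_image[OF continuous_on_subset[OF ct] compact_Icc[of 0 T]]]
      by (force simp: bounded_iff)
    have der: "((\<lambda>s. \<phi> s (y - c * s)) has_real_derivative ?\<psi> t (y - c * t)) (at t)" for t
    proof -
      have "((\<lambda>s. y - c * s) has_real_derivative - c) (at t)"
        by (auto intro!: derivative_eq_intros)
      from curried_chain_rule[OF _ DERIV_ident this, of \<phi>] test_fun2_differentiable[OF \<phi>, of "[]"]
      show ?thesis by simp
    qed
    have "(LINT t:{0..T}|lebesgue. ?\<psi> t (y - c * t)) = \<phi> T (y - c * T) - \<phi> 0 (y - c * 0)"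
    proof (rule set_integral_FTC_interior_strong[OF finite.emptyI T])
      show "continuous_on {0..T} (\<lambda>s. \<phi> s (y - c * s))"
        using DERIV_isCont[OF der] by (simp add: continuous_at_imp_continuous_on)
      show "set_integrable lebesgue {0..T} (\<lambda>t. ?\<psi> t (y - c * t))"
        using D by (intro set_integrable_lebesgue_bounded[OF borel_measurable_continuous_onI[OF ct]]) auto
    qed (rule der)
    \<comment> \<open>Both end values vanish because the support of \<open>\<phi>\<close> lies
      strictly between times 0 and \<open>T\<close>.\<close>
    also have "\<dots> = 0"
      using \<phi> unfolding test_fun2_def by force
    finally show ?thesis by simp
  qed
  have "(LINT t:{0..T}|lebesgue. LINT x:{0..2 * pi}|lebesgue. U' (x + c * t) * ?\<psi> t x) =
      (LINT t:{0..T}|lebesgue. LINT y:{0..2 * pi}|lebesgue. ?F (t, y))"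
    by (simp add: shift)
  also have "\<dots> = (LINT p:{0..T} \<times> {0..2 * pi}|lebesgue. ?F p)"
    by (rule set_integral_box_iterated(1)[OF F FB, symmetric])
  also have "\<dots> = (LINT y:{0..2 * pi}|lebesgue. LINT t:{0..T}|lebesgue. ?F (t, y))"
    by (rule set_integral_box_iterated(2)[OF F FB])
  also have "\<dots> = 0" by (simp only: prod.sel inner) simp
  finally show ?thesis .
qed

text \<open>Both orders are needed: integration by parts in time wants \<open>t\<close> innermost,
  integration by parts in space wants \<open>x\<close> innermost.\<close>

lemma pairing_iterated:
  fixes \<psi> :: "real \<Rightarrow> real \<Rightarrow> real"
  assumes V: "V = U \<or> V = U'" and \<psi>: "continuous_on UNIV (\<lambda>p. \<psi> (fst p) (snd p))"
  shows "pairing T (\<lambda>t x. V (x + c * t)) \<psi> =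
      (LINT t:{0..T}|lebesgue. LINT x:{0..2 * pi}|lebesgue. V (x + c * t) * \<psi> t x)"
    and "pairing T (\<lambda>t x. V (x + c * t)) \<psi> =
      (LINT x:{0..2 * pi}|lebesgue. LINT t:{0..T}|lebesgue. V (x + c * t) * \<psi> t x)"
    and "set_integrable lebesgue ({0..T} \<times> {0..2 * pi}) (\<lambda>(t, x). V (x + c * t) * \<psi> t x)"
proof -
  let ?F = "\<lambda>(t, x). V (x + c * t) * \<psi> t x"
  have V': "V \<in> borel_measurable borel" "\<And>x. \<bar>V x\<bar> \<le> B" using V borel borel' bnd bnd' by auto
  obtain C where C: "\<And>t x. t \<in> {0..T} \<Longrightarrow> x \<in> {0..2 * pi} \<Longrightarrow> \<bar>\<psi> t x\<bar> \<le> C"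
    using continuous_bounded_box[OF \<psi>, of 0 T 0 "2 * pi"] by auto
  have "(\<lambda>p. V (snd p + c * fst p)) \<in> borel_measurable borel"
    by (intro measurable_compose[OF _ V'(1)] borel_measurable_continuous_onI continuous_intros)
  then have F: "?F \<in> borel_measurable borel"
    using borel_measurable_continuous_onI[OF \<psi>] by (simp add: case_prod_beta borel_measurable_times)
  have FB: "\<bar>?F (t, x)\<bar> \<le> B * C" if "t \<in> {0..T}" "x \<in> {0..2 * pi}" for t x
    using V'(2)[of "x + c * t"] C[OF that] by (auto simp: abs_mult intro!: mult_mono)
  show "pairing T (\<lambda>t x. V (x + c * t)) \<psi> =
      (LINT t:{0..T}|lebesgue. LINT x:{0..2 * pi}|lebesgue. V (x + c * t) * \<psi> t x)"
    "pairing T (\<lambda>t x. V (x + c * t)) \<psi> =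
      (LINT x:{0..2 * pi}|lebesgue. LINT t:{0..T}|lebesgue. V (x + c * t) * \<psi> t x)"
    unfolding pairing_def using set_integral_box_iterated[OF F FB] by simp_all
  show "set_integrable lebesgue ({0..T} \<times> {0..2 * pi}) ?F"
    using FB by (intro set_integrable_lebesgue_bounded[OF F, where B = "B * C"]) (auto intro: compact_Times)
qed

text \<open>The weak form of the chain rule for \<open>U (x + c * t)\<close> in time, obtained for
  each fixed \<open>x\<close> and then integrated.\<close>

lemma pairing_dt:
  assumes \<phi>: "test_fun2 T \<phi>" and T: "0 \<le> T" and c: "c\<^sup>2 = 1"
  shows "pairing T (\<lambda>t x. U (x + c * t)) (dt \<phi>) = - c * pairing T (\<lambda>t x. U' (x + c * t)) \<phi>"
proof -
  have cont: "continuous_on UNIV (\<lambda>p. \<phi> (fst p) (snd p))" "continuous_on UNIV (\<lambda>p. dt \<phi> (fst p) (snd p))"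
    using test_fun2_continuous[OF \<phi>, of "[]"] test_fun2_continuous[OF \<phi>, of "[True]"] by simp_all
  have zero: "\<phi> 0 x = 0" "\<phi> T x = 0" for x
    using \<phi> unfolding test_fun2_def by force+
  have "(LINT t:{0..T}|lebesgue. U (x + c * t) * dt \<phi> t x) =
      - c * (LINT t:{0..T}|lebesgue. U' (x + c * t) * \<phi> t x)" for x
  proof -
    have "continuous_on UNIV (\<lambda>t. dt \<phi> t x)"
      using continuous_on_compose2[OF cont(2), of UNIV "\<lambda>t. (t, x)"] by (simp add: continuous_on_Pair)
    from integral_by_parts_time[OF _ this zero T c] test_fun2_has_dt[OF \<phi>, of "[]"]
    show ?thesis by (simp add: mult.assoc)
  qed
  then show ?thesis
    by (simp only: pairing_iterated(2)[OF _ cont(1)] pairing_iterated(2)[OF _ cont(2)]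
        set_integral_mult_right simp_thms)
qed

text \<open>Only one derivative is moved off the test function, since \<open>U'\<close> may
  jump.\<close>

lemma pairing_dx_dx:
  assumes \<phi>: "test_fun2 T \<phi>"
  shows "pairing T (\<lambda>t x. U (x + c * t)) (dx (dx \<phi>)) = - pairing T (\<lambda>t x. U' (x + c * t)) (dx \<phi>)"
proof -
  have cont: "continuous_on UNIV (\<lambda>p. dx \<phi> (fst p) (snd p))" "continuous_on UNIV (\<lambda>p. dx (dx \<phi>) (fst p) (snd p))"
    using test_fun2_continuous[OF \<phi>, of "[False]"] test_fun2_continuous[OF \<phi>, of "[False, False]"] by simp_all
  \<comment> \<open>The sign is written as the factor \<open>-1\<close> so that the rule pulling
    constants out of the integral applies to it.\<close>
  have "(LINT x:{0..2 * pi}|lebesgue. U (x + c * t) * dx (dx \<phi>) t x) =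
      (-1) * (LINT x:{0..2 * pi}|lebesgue. U' (x + c * t) * dx \<phi> t x)" for t
    unfolding mult_minus1
  proof (rule integral_by_parts_space)
    show "continuous_on UNIV (dx (dx \<phi>) t)"
      using continuous_on_compose2[OF cont(2), of UNIV "\<lambda>x. (t, x)"] by (simp add: continuous_on_Pair)
  qed (use test_fun2_has_dx[OF \<phi>, of "[False]"] test_fun2_periodic[OF \<phi>, of "[False]"] in auto)
  then have "pairing T (\<lambda>t x. U (x + c * t)) (dx (dx \<phi>)) =
      (-1) * pairing T (\<lambda>t x. U' (x + c * t)) (dx \<phi>)"
    by (simp only: pairing_iterated(1)[OF _ cont(1)] pairing_iterated(1)[OF _ cont(2)]
        set_integral_mult_right simp_thms)
  then show ?thesis by simp
qed

text \<open>After one integration by parts in each variable, \<open>c * c = 1\<close> collects the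
  two terms into \<open>U'\<close> paired with \<open>dt \<phi> - c * dx \<phi>\<close>, which
  \<open>transport\<close> annihilates.\<close>

lemma pairing_wave:
  assumes \<phi>: "test_fun2 T \<phi>" and T: "0 \<le> T" and c: "c\<^sup>2 = 1"
  shows "pairing T (\<lambda>t x. U (x + c * t)) (\<lambda>t x. dt (dt \<phi>) t x - dx (dx \<phi>) t x) = 0"
proof -
  have cont: "continuous_on UNIV (\<lambda>p. iter_partial bs \<phi> (fst p) (snd p))" for bs
    by (rule test_fun2_continuous[OF \<phi>])
  note cont' = cont[of "[True]", simplified] cont[of "[False]", simplified]
    cont[of "[True, True]", simplified] cont[of "[False, False]", simplified]
  have "pairing T (\<lambda>t x. U (x + c * t)) (\<lambda>t x. dt (dt \<phi>) t x - dx (dx \<phi>) t x) =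
      pairing T (\<lambda>t x. U (x + c * t)) (dt (dt \<phi>)) - pairing T (\<lambda>t x. U (x + c * t)) (dx (dx \<phi>))"
    by (intro pairing_diff_right pairing_iterated(3) cont') auto
  also have "\<dots> = - c * pairing T (\<lambda>t x. U' (x + c * t)) (dt \<phi>) + pairing T (\<lambda>t x. U' (x + c * t)) (dx \<phi>)"
    using pairing_dt[OF test_fun2_dt[OF \<phi>] T c] pairing_dx_dx[OF \<phi>] by simp
  also have "\<dots> = - c * (pairing T (\<lambda>t x. U' (x + c * t)) (dt \<phi>) - c * pairing T (\<lambda>t x. U' (x + c * t)) (dx \<phi>))"
  proof -
    have "c * (c * z) = z" for z using c by (simp add: power2_eq_square flip: mult.assoc)
    then show ?thesis by (simp add: right_diff_distrib)
  qed
  also have "pairing T (\<lambda>t x. U' (x + c * t)) (dt \<phi>) - c * pairing T (\<lambda>t x. U' (x + c * t)) (dx \<phi>) =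
      pairing T (\<lambda>t x. U' (x + c * t)) (\<lambda>t x. dt \<phi> t x - c * dx \<phi> t x)"
    unfolding pairing_mult_right[symmetric]
    by (intro pairing_diff_right[symmetric] pairing_iterated(3) cont' continuous_on_mult continuous_on_const) auto
  also have "\<dots> = 0"
    using continuous_on_diff[OF cont'(1) continuous_on_mult[OF continuous_on_const cont'(2), of c]]
    by (subst pairing_iterated(1)) (auto simp: transport[OF \<phi> T])
  finally show ?thesis by simp
qed

section \<open>The solution as a sum of two opposite travelling waves\<close>

definition u :: "real \<Rightarrow> real \<Rightarrow> real" where "u t x = U (x + t) + U (x - t)"
definition u_x :: "real \<Rightarrow> real \<Rightarrow> real" where "u_x t x = U' (x + t) + U' (x - t)"
definition u_t :: "real \<Rightarrow> real \<Rightarrow> real" where "u_t t x = U' (x + t) - U' (x - t)"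

lemma shift_L2T: "(\<lambda>x. U (x + s)) \<in> L2T" "(\<lambda>x. U' (x + s)) \<in> L2T"
  using per_shift bnd bnd' by (auto intro!: bounded_borel_L2T[where B = B])

lemma u_borel: "u t \<in> borel_measurable borel" "u_x t \<in> borel_measurable borel" "u_t t \<in> borel_measurable borel"
  unfolding u_def u_x_def u_t_def by measurable

lemma u_bounded: "\<bar>u t x\<bar> \<le> 2 * B" "\<bar>u_x t x\<bar> \<le> 2 * B" "\<bar>u_t t x\<bar> \<le> 2 * B"
  using bnd[of "x + t"] bnd[of "x - t"] bnd'[of "x + t"] bnd'[of "x - t"]
  by (auto simp: u_def u_x_def u_t_def)

lemma u_periodic: "periodic (u t)" "periodic (u_x t)" "periodic (u_t t)"
  using per_shift[of t] per_shift[of "- t"] by (auto simp: u_def u_x_def u_t_def periodic_def)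

lemma u_L2T: "u t \<in> L2T" "u_x t \<in> L2T" "u_t t \<in> L2T"
  using u_borel u_bounded u_periodic by (auto intro!: bounded_borel_L2T[where B = "2 * B"])

lemma u_weak_deriv: "has_weak_deriv (u t) (u_x t)"
  using has_weak_deriv_add[OF shift_L2T(1)[of t] shift_L2T(1)[of "- t"] shift_L2T(2)[of t] shift_L2T(2)[of "- t"]
      has_weak_deriv_shift has_weak_deriv_shift]
  by (simp add: u_def[abs_def] u_x_def[abs_def])

lemma u_H1T: "u t \<in> H1T"
  unfolding H1T_def using u_L2T u_weak_deriv by blast

text \<open>For a fixed time the bad points are the \<open>x\<close> with \<open>x + t\<close> or
  \<open>x - t\<close> in \<open>S\<close>. This null set moves with \<open>t\<close>, so the claim
  is made for one time only.\<close>

lemma AE_isCont: "AE x in lebesgue. isCont (\<lambda>s. u s x) t" "AE x in lebesgue. isCont (\<lambda>s. u_x s x) t"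
  "AE x in lebesgue. isCont (\<lambda>s. u_t s x) t"
proof -
  have U: "isCont U x" for x using cont by (simp add: continuous_on_eq_continuous_at)
  have ae: "AE x in lebesgue. x + t \<notin> S \<and> x - t \<notin> S"
    using AE_regular[of t] AE_regular[of "- t"] by eventually_elim simp
  show "AE x in lebesgue. isCont (\<lambda>s. u s x) t"
    unfolding u_def
    by (intro AE_I2 continuous_intros isCont_o2[OF _ U])
  show "AE x in lebesgue. isCont (\<lambda>s. u_x s x) t" "AE x in lebesgue. isCont (\<lambda>s. u_t s x) t"
    using ae unfolding u_x_def u_t_def
    by (eventually_elim; intro continuous_intros isCont_o2[OF _ cont']; simp)+
qed

lemma continuous_path_u: "continuous_path H1_norm T u"
  unfolding continuous_path_def
proof
  fix t
  \<comment> \<open>The choice hidden in \<open>weak_deriv\<close> is made anew for each difference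
    of slices; uniqueness replaces it by the explicit difference of the \<open>u_x\<close>.\<close>
  have "L2_norm (weak_deriv (\<lambda>x. u s x - u t x)) = L2_norm (\<lambda>x. u_x s x - u_x t x)" for s
  proof (rule L2_norm_weak_deriv)
    have "\<bar>u_x s x - u_x t x\<bar> \<le> 4 * B" for x
      using u_bounded(2)[of s x] u_bounded(2)[of t x] by linarith
    then show "(\<lambda>x. u_x s x - u_x t x) \<in> L2T"
      using u_periodic u_borel by (intro bounded_borel_L2T[where B = "4 * B"]) (auto simp: periodic_def)
  qed (intro has_weak_deriv_diff u_L2T u_weak_deriv)
  moreover have "((\<lambda>s. sqrt ((L2_norm (\<lambda>x. u s x - u t x))\<^sup>2 + (L2_norm (\<lambda>x. u_x s x - u_x t x))\<^sup>2))
      \<longlongrightarrow> sqrt (0\<^sup>2 + 0\<^sup>2)) (at t within {0..T})"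
    by (intro tendsto_intros L2_norm_diff_tendsto_0[OF u_borel(1) u_bounded(1) AE_isCont(1)]
        L2_norm_diff_tendsto_0[OF u_borel(2) u_bounded(2) AE_isCont(2)])
  ultimately show "((\<lambda>s. H1_norm (\<lambda>x. u s x - u t x)) \<longlongrightarrow> 0) (at t within {0..T})"
    by (simp add: H1_norm_def)
qed

lemma continuous_path_u_t: "continuous_path L2_norm T u_t"
  unfolding continuous_path_def
  using L2_norm_diff_tendsto_0[OF u_borel(3) u_bounded(3) AE_isCont(3)] by blast

lemma wave_solution:
  assumes T: "0 \<le> T"
  shows "wave_solution T (u 0) (u_t 0) u u_t"
proof -
  note int = pairing_iterated(3)[where c = 1, simplified] pairing_iterated(3)[where c = "- 1", simplified]
  have "has_weak_dt T u u_t"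
    unfolding has_weak_dt_def
  proof (intro allI impI)
    fix \<phi> assume \<phi>: "test_fun2 T \<phi>"
    have c: "continuous_on UNIV (\<lambda>p. \<phi> (fst p) (snd p))" "continuous_on UNIV (\<lambda>p. dt \<phi> (fst p) (snd p))"
      using test_fun2_continuous[OF \<phi>, of "[]"] test_fun2_continuous[OF \<phi>, of "[True]"] by simp_all
    show "pairing T u (dt \<phi>) = - pairing T u_t \<phi>"
      using pairing_dt[OF \<phi> T, of 1] pairing_dt[OF \<phi> T, of "- 1"] c
      by (simp add: u_def[abs_def] u_t_def[abs_def] int pairing_add_left pairing_diff_left)
  qed
  moreover have "weak_wave_eq T u"
    unfolding weak_wave_eq_def
  proof (intro allI impI)
    fix \<phi> assume \<phi>: "test_fun2 T \<phi>"
    let ?\<psi> = "\<lambda>t x. dt (dt \<phi>) t x - dx (dx \<phi>) t x"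
    have c: "continuous_on UNIV (\<lambda>p. ?\<psi> (fst p) (snd p))"
      using test_fun2_continuous[OF \<phi>, of "[True, True]"] test_fun2_continuous[OF \<phi>, of "[False, False]"]
      by (intro continuous_on_diff) simp_all
    have "pairing T u ?\<psi> = pairing T (\<lambda>t x. U (x + t)) ?\<psi> + pairing T (\<lambda>t x. U (x - t)) ?\<psi>"
      unfolding u_def[abs_def] using int[OF _ c, where V = U] by (intro pairing_add_left) auto
    then show "pairing T u ?\<psi> = 0"
      using pairing_wave[OF \<phi> T, of 1] pairing_wave[OF \<phi> T, of "- 1"] by simp
  qed
  moreover have "(\<lambda>(t, x). u t x) \<in> borel_measurable (lebesgue_on ({0..T} \<times> UNIV))"
    "(\<lambda>(t, x). u_t t x) \<in> borel_measurable (lebesgue_on ({0..T} \<times> UNIV))"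
  proof -
    have [measurable]: "(\<lambda>p. snd p + fst p) \<in> borel_measurable (borel :: (real \<times> real) measure)"
      "(\<lambda>p. snd p - fst p) \<in> borel_measurable (borel :: (real \<times> real) measure)"
      by (intro borel_measurable_continuous_onI continuous_intros)+
    have "(\<lambda>(t, x). u t x) \<in> borel_measurable borel" "(\<lambda>(t, x). u_t t x) \<in> borel_measurable borel"
      unfolding u_def u_t_def case_prod_unfold by measurable
    then show "(\<lambda>(t, x). u t x) \<in> borel_measurable (lebesgue_on ({0..T} \<times> UNIV))"
      "(\<lambda>(t, x). u_t t x) \<in> borel_measurable (lebesgue_on ({0..T} \<times> UNIV))"
      by (auto intro!: measurable_restrict_space1 measurable_completion)
  qed
  ultimately show ?thesis
    unfolding wave_solution_def
    using u_H1T u_L2T(3) continuous_path_u continuous_path_u_t by auto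
qed

end

section \<open>The square wave\<close>

locale square_wave =
  fixes h :: "real \<Rightarrow> real"
  assumes h_periodic: "periodic h"
    and h_neg: "\<And>x. x \<in> {0..<pi} \<Longrightarrow> h x = -1"
    and h_pos: "\<And>x. x \<in> {pi..<2 * pi} \<Longrightarrow> h x = 1"
begin

text \<open>A closed form from which measurability and continuity off the zeros of the sine are
  visible. At those zeros \<open>- cos x\<close> gives the right-hand value: -1 at 0 and 1 at
  \<open>pi\<close>.\<close>

lemma h_eq: "h x = (if sin x > 0 then -1 else if sin x < 0 then 1 else - cos x)"
proof -
  obtain r k where r: "r \<in> {0..<2 * pi}" and x: "x = r + 2 * pi * of_int k"
    by (rule two_pi_reduce)
  have per: "sin x = sin r" "cos x = cos r" "h x = h r"
    using periodic_add_int[of sin r k] periodic_add_int[of cos r k] periodic_add_int[OF h_periodic, of r k]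
    by (simp_all add: x periodic_def)
  consider "r = 0" | "0 < r" "r < pi" | "r = pi" | "pi < r" "r < 2 * pi"
    using r by force
  then show ?thesis
  proof cases
    case 2
    then show ?thesis using sin_gt_zero[of r] h_neg[of r] by (simp add: per)
  next
    case 4
    then have "sin r < 0" by (intro sin_lt_zero) auto
    then show ?thesis using 4 h_pos[of r] by (simp add: per)
  qed (use per h_neg[of 0] h_pos[of pi] in auto)
qed

lemma h_abs: "\<bar>h x\<bar> = 1"
  using sin_zero_abs_cos_one[of x] by (auto simp: h_eq)

text \<open>On \<open>{-pi..pi}\<close> the function \<open>arccos (cos x)\<close> is
  \<open>\<bar>x\<bar>\<close>, so its negative is the triangle wave with slope -1 on the first
  half-period and 1 on the second. The bound \<open>pi\<close> is the height of the triangle and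
  exceeds \<open>\<bar>h x\<bar> = 1\<close>.\<close>

sublocale travelling_profile "\<lambda>x. - arccos (cos x)" h "{x. sin x = 0}" pi
proof
  show "periodic (\<lambda>x. - arccos (cos x))" by (simp add: periodic_def)
  show "continuous_on UNIV (\<lambda>x. - arccos (cos x))"
    by (intro continuous_intros) auto
  show "h \<in> borel_measurable borel"
    unfolding h_eq[abs_def] by measurable
  show "\<bar>- arccos (cos x)\<bar> \<le> pi" for x
    using arccos_lbound[of "cos x"] arccos_ubound[of "cos x"] by simp
  show "\<bar>h x\<bar> \<le> pi" for x
    using pi_ge_two by (simp add: h_abs)
  show "finite ({x. sin x = 0} \<inter> {a..b})" for a b :: real
  proof (rule finite_subset)
    show "{x. sin x = 0} \<inter> {a..b} \<subseteq> (\<lambda>i::int. real_of_int i * pi) ` {\<lfloor>a / pi\<rfloor>..\<lceil>b / pi\<rceil>}"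
    proof
      fix x assume x: "x \<in> {x. sin x = 0} \<inter> {a..b}"
      then obtain i :: int where i: "x = real_of_int i * pi" by (auto simp: sin_zero_iff_int2)
      then have "a / pi \<le> real_of_int i" "real_of_int i \<le> b / pi"
        using x by (auto simp: field_simps)
      then have "i \<in> {\<lfloor>a / pi\<rfloor>..\<lceil>b / pi\<rceil>}" by (auto simp: floor_le_iff le_ceiling_iff)
      with i show "x \<in> (\<lambda>i::int. real_of_int i * pi) ` {\<lfloor>a / pi\<rfloor>..\<lceil>b / pi\<rceil>}" by blast
    qed
  qed simp
next
  fix x :: real assume "x \<notin> {x. sin x = 0}"
  then have x: "sin x \<noteq> 0" by simp
  have "(cos x)\<^sup>2 < 1" using x by (simp add: cos_squared_eq)
  then have "\<bar>cos x\<bar> < 1" by (simp add: abs_square_less_1)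
  then have "((\<lambda>x. - arccos (cos x)) has_real_derivative - (inverse (- sqrt (1 - (cos x)\<^sup>2)) * - sin x)) (at x)"
    by (intro DERIV_minus DERIV_chain2[OF DERIV_arccos DERIV_cos]) auto
  moreover have "sqrt (1 - (cos x)\<^sup>2) = \<bar>sin x\<bar>" by (simp add: cos_squared_eq)
  ultimately show "((\<lambda>x. - arccos (cos x)) has_real_derivative h x) (at x)"
    using x by (auto simp: h_eq abs_if field_simps split: if_splits)
  have "\<forall>\<^sub>F y in nhds x. sin y \<noteq> 0"
    using x isCont_sin[of x]
    by (auto simp: eventually_nhds_conv_at isCont_def intro: tendsto_imp_eventually_ne)
  then have "\<forall>\<^sub>F y in nhds x. h y = - sgn (sin y)"
    by eventually_elim (auto simp: h_eq sgn_if)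
  moreover have "isCont (\<lambda>y. - sgn (sin y)) x"
    using x by (intro continuous_intros) auto
  ultimately show "isCont h x" by (subst isCont_cong)
qed (rule h_periodic)

lemma h_return:
  assumes "x \<in> {0..<2 * pi}"
  obtains m where "x \<in> {m..<m + pi}" "\<And>y. y \<in> {m..<m + pi} \<Longrightarrow> h y = h x"
proof (cases "x < pi")
  case True
  then show ?thesis using that[of 0] h_neg assms by auto
next
  case False
  then show ?thesis using that[of pi] h_pos assms by auto
qed

lemma h_shift_2pi: "h (x - 2 * pi) = h x" "h (x + 2 * pi) = h x"
  using periodic_add_int[OF h_periodic, of x "-1"] periodic_add_int[OF h_periodic, of x 1] by simp_all

text \<open>The argument of \<open>h\<close> moves at speed 2, so crossing a half-period of length
  \<open>pi\<close> takes time \<open>pi / 2\<close>.\<close>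

lemma emeasure_return:
  assumes "x \<in> {0..<2 * pi}"
  shows "emeasure lebesgue {r \<in> {0..2 * pi}. h (x + 2 * r) = h x} \<ge> ennreal (pi / 2)" (is "emeasure lebesgue ?A \<ge> _")
    and "emeasure lebesgue {r \<in> {0..2 * pi}. h x = h (x - 2 * r)} \<ge> ennreal (pi / 2)" (is "emeasure lebesgue ?B \<ge> _")
proof -
  obtain m where m: "x \<in> {m..<m + pi}" "\<And>y. y \<in> {m..<m + pi} \<Longrightarrow> h y = h x"
    using h_return[OF assms] by blast
  have "?A \<in> sets borel" "?B \<in> sets borel" by measurable
  then have meas: "?A \<in> sets lebesgue" "?B \<in> sets lebesgue" by auto
  \<comment> \<open>These are the times at which \<open>x + 2 * r\<close> runs through the
    half-period of \<open>x\<close> one period later. As \<open>m \<le> x < m + pi\<close>, they lie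
    between \<open>pi / 2\<close> and \<open>3 * pi / 2\<close>, so the crossing is
    complete.\<close>
  have "{(2 * pi + m - x) / 2..<(3 * pi + m - x) / 2} \<subseteq> ?A"
  proof
    fix r assume r: "r \<in> {(2 * pi + m - x) / 2..<(3 * pi + m - x) / 2}"
    then have "x + 2 * r - 2 * pi \<in> {m..<m + pi}" by auto
    then have "h (x + 2 * r) = h x" using m(2) h_shift_2pi(1)[of "x + 2 * r"] by simp
    moreover have "0 \<le> r \<and> r \<le> 2 * pi" using r m(1) pi_gt_zero by auto
    ultimately show "r \<in> ?A" by simp
  qed
  from emeasure_mono[OF this meas(1)]
  have "emeasure lborel {(2 * pi + m - x) / 2..<(3 * pi + m - x) / 2} \<le> emeasure lebesgue ?A" by simp
  also have "emeasure lborel {(2 * pi + m - x) / 2..<(3 * pi + m - x) / 2} = ennreal ((3 * pi + m - x) / 2 - (2 * pi + m - x) / 2)"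
    by (rule emeasure_lborel_Ico) simp
  also have "(3 * pi + m - x) / 2 - (2 * pi + m - x) / 2 = pi / 2" by (simp add: field_simps)
  finally show "emeasure lebesgue ?A \<ge> ennreal (pi / 2)" .
  \<comment> \<open>The mirror image, one period earlier; the backward motion swaps the open and the
    closed end.\<close>
  have "{(x - m + pi) / 2<..(x - m + 2 * pi) / 2} \<subseteq> ?B"
  proof
    fix r assume r: "r \<in> {(x - m + pi) / 2<..(x - m + 2 * pi) / 2}"
    then have "x - 2 * r + 2 * pi \<in> {m..<m + pi}" by auto
    then have "h (x - 2 * r) = h x" using m(2) h_shift_2pi(2)[of "x - 2 * r"] by simp
    moreover have "0 \<le> r \<and> r \<le> 2 * pi" using r m(1) pi_gt_zero by auto
    ultimately show "r \<in> ?B" by simp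
  qed
  from emeasure_mono[OF this meas(2)]
  have "emeasure lborel {(x - m + pi) / 2<..(x - m + 2 * pi) / 2} \<le> emeasure lebesgue ?B" by simp
  also have "emeasure lborel {(x - m + pi) / 2<..(x - m + 2 * pi) / 2} = ennreal ((x - m + 2 * pi) / 2 - (x - m + pi) / 2)"
    by (rule emeasure_lborel_Ioc) simp
  also have "(x - m + 2 * pi) / 2 - (x - m + pi) / 2 = pi / 2" by (simp add: field_simps)
  finally show "emeasure lebesgue ?B \<ge> ennreal (pi / 2)" .
qed

section \<open>The set \<open>G\<close> and its geometric control\<close>

definition G :: "(real \<times> real) set" where
  "G = {(t, x). t \<in> {0..2 * pi} \<and> x \<in> {0..2 * pi} \<and> h (x + t) = h (x - t)}"

lemma sets_G: "G \<in> sets lebesgue"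
proof -
  have [measurable]: "(\<lambda>p. snd p + fst p) \<in> borel_measurable (borel :: (real \<times> real) measure)"
    "(\<lambda>p. snd p - fst p) \<in> borel_measurable (borel :: (real \<times> real) measure)"
    by (intro borel_measurable_continuous_onI continuous_intros)+
  have "G = ({0..2 * pi} \<times> {0..2 * pi}) \<inter> {p \<in> space borel. h (snd p + fst p) = h (snd p - fst p)}"
    by (auto simp: G_def)
  moreover have "{p \<in> space borel. h (snd p + fst p) = h (snd p - fst p)} \<in> sets (borel :: (real \<times> real) measure)"
    by measurable
  moreover have "({0..2 * pi} \<times> {0..2 * pi}) \<in> sets (borel :: (real \<times> real) measure)"
    by (intro borel_closed closed_Times) auto
  ultimately show ?thesis by auto
qed

text \<open>The condition on \<open>h\<close> is itself periodic in \<open>x\<close>, and every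
  \<open>x\<close> has a translate in \<open>{0..2 * pi}\<close>, so the spatial constraint
  disappears.\<close>

lemma periodize_G: "(t, x) \<in> periodize G \<longleftrightarrow> t \<in> {0..2 * pi} \<and> h (x + t) = h (x - t)"
proof -
  have shift: "h (x + 2 * of_int k * pi + t) = h (x + t)" "h (x + 2 * of_int k * pi - t) = h (x - t)" for k
    using periodic_add_int[OF h_periodic, of "x + t" k] periodic_add_int[OF h_periodic, of "x - t" k]
    by (simp_all add: algebra_simps)
  obtain r k where "r \<in> {0..<2 * pi}" "x = r + 2 * pi * of_int k" by (rule two_pi_reduce)
  then have "x + 2 * of_int (- k) * pi \<in> {0..2 * pi}" by (auto simp: algebra_simps)
  then show ?thesis
    using shift by (auto simp: periodize_def G_def simp del: of_int_minus)
qed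

lemma GCC_G: "GCC (2 * pi) G"
  unfolding GCC_def
proof (intro conjI exI[of _ "pi / 2"])
  \<comment> \<open>At the point \<open>(r, x + r)\<close> the arguments of \<open>h\<close> are
    \<open>x + 2 * r\<close> and \<open>x\<close>; at \<open>(r, x - r)\<close> they are
    \<open>x\<close> and \<open>x - 2 * r\<close>. The factor \<open>sqrt 2\<close> is the length of
    the direction vector.\<close>
  have line: "line_meas (0, x) (1, 1) (periodize G \<inter> {(s, x + s) |s. s \<in> {0..2 * pi}}) =
      ennreal (sqrt 2) * emeasure lebesgue {r \<in> {0..2 * pi}. h (x + 2 * r) = h x}"
    "line_meas (0, x) (1, - 1) (periodize G \<inter> {(s, x - s) |s. s \<in> {0..2 * pi}}) =
      ennreal (sqrt 2) * emeasure lebesgue {r \<in> {0..2 * pi}. h x = h (x - 2 * r)}" for x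
  proof -
    have "{r. (0, x) + r *\<^sub>R (1, 1) \<in> periodize G \<inter> {(s, x + s) |s. s \<in> {0..2 * pi}}} =
        {r \<in> {0..2 * pi}. h (x + 2 * r) = h x}"
      "{r. (0, x) + r *\<^sub>R (1, - 1) \<in> periodize G \<inter> {(s, x - s) |s. s \<in> {0..2 * pi}}} =
        {r \<in> {0..2 * pi}. h x = h (x - 2 * r)}"
      by (auto simp: periodize_G add.commute)
    then show "line_meas (0, x) (1, 1) (periodize G \<inter> {(s, x + s) |s. s \<in> {0..2 * pi}}) =
        ennreal (sqrt 2) * emeasure lebesgue {r \<in> {0..2 * pi}. h (x + 2 * r) = h x}"
      "line_meas (0, x) (1, - 1) (periodize G \<inter> {(s, x - s) |s. s \<in> {0..2 * pi}}) =
        ennreal (sqrt 2) * emeasure lebesgue {r \<in> {0..2 * pi}. h x = h (x - 2 * r)}"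
      by (simp_all add: line_meas_def norm_Pair)
  qed
  have "1 * ennreal (pi / 2) \<le> ennreal (sqrt 2) * e" if "ennreal (pi / 2) \<le> e" for e
    using that by (intro mult_mono) (auto simp: ennreal_1[symmetric] simp del: ennreal_1)
  then have le: "ennreal (pi / 2) \<le> ennreal (sqrt 2) * e" if "ennreal (pi / 2) \<le> e" for e
    using that by simp
  \<comment> \<open>\<open>emeasure_return\<close> covers the half-open period, so the right
    endpoint is discarded as a null set.\<close>
  have "AE x in lebesgue. x \<noteq> 2 * pi"
    by (intro AE_completion AE_lborel_singleton)
  then show "AE x\<in>{0..2 * pi} in lebesgue.
      line_meas (0, x) (1, 1) (periodize G \<inter> {(s, x + s) |s. s \<in> {0..2 * pi}}) \<ge> ennreal (pi / 2) \<and>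
      line_meas (0, x) (1, - 1) (periodize G \<inter> {(s, x - s) |s. s \<in> {0..2 * pi}}) \<ge> ennreal (pi / 2)"
    unfolding line by eventually_elim (intro impI conjI le emeasure_return, auto)
qed (use sets_G in \<open>auto simp: G_def\<close>)

lemma u_t_G: "(t, x) \<in> G \<Longrightarrow> u_t t x = 0"
  by (simp add: G_def u_t_def)

text \<open>At time 0 the two waves coincide, so the space derivative is \<open>2 * h x\<close>,
  with square 4, over a length of \<open>2 * pi\<close>.\<close>

lemma u_initial_energy: "(L2_norm (weak_deriv (u 0)))\<^sup>2 = 8 * pi"
proof -
  have "(u_x 0 x)\<^sup>2 = 4" for x
    using h_abs[of x] by (auto simp: u_x_def power2_eq_square abs_if split: if_splits)
  then have "L2_norm (u_x 0) = sqrt (8 * pi)"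
    by (simp add: L2_norm_def set_lebesgue_integral_def)
  then show ?thesis
    using L2_norm_weak_deriv[OF u_L2T(2) u_weak_deriv, of 0] by simp
qed

end

theorem mainTheorem4:
  fixes T :: real and h :: "real \<Rightarrow> real" and G :: "(real \<times> real) set"
  assumes "T = 2 * pi"
    and "\<forall>x. h (x + 2 * pi) = h x"
    and "\<forall>x\<in>{0..<pi}. h x = -1"
    and "\<forall>x\<in>{pi..<2 * pi}. h x = 1"
    and "G = {(t, x). t \<in> {0..2 * pi} \<and> x \<in> {0..2 * pi} \<and> h (x + t) = h (x - t)}"
  shows "GCC T G \<and>
    \<not> (\<exists>C>0. \<forall>u0 u1 u v. u0 \<in> H1T \<and> u1 \<in> L2T \<and> wave_solution T u0 u1 u v \<longrightarrow>
          (L2_norm (weak_deriv u0))\<^sup>2 + (L2_norm u1)\<^sup>2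
            \<le> C * (LINT (t, x):G|lebesgue. (v t x)\<^sup>2))"
proof -
  interpret square_wave h
    using assms by unfold_locales (auto simp: periodic_def)
  have G: "G = square_wave.G h" by (simp add: assms(5) G_def)
  have "(LINT (t, x):G|lebesgue. (u_t t x)\<^sup>2) = (LINT p::real \<times> real|lebesgue. 0)"
    unfolding set_lebesgue_integral_def
    by (intro Bochner_Integration.integral_cong) (auto simp: G u_t_G indicator_def)
  then have "(LINT (t, x):G|lebesgue. (u_t t x)\<^sup>2) = 0" by simp
  moreover have "(L2_norm (weak_deriv (u 0)))\<^sup>2 + (L2_norm (u_t 0))\<^sup>2 > 0"
    by (simp add: u_initial_energy add_pos_nonneg)
  moreover have "wave_solution T (u 0) (u_t 0) u u_t"
    using assms(1) by (intro wave_solution) simp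
  \<comment> \<open>For this solution the right side is \<open>C * 0\<close> whatever
    \<open>C\<close> is, while the left side is positive.\<close>
  ultimately have "\<not> (\<forall>u0 u1 u v. u0 \<in> H1T \<and> u1 \<in> L2T \<and> wave_solution T u0 u1 u v \<longrightarrow>
      (L2_norm (weak_deriv u0))\<^sup>2 + (L2_norm u1)\<^sup>2 \<le> C * (LINT (t, x):G|lebesgue. (v t x)\<^sup>2))" for C
    using u_H1T[of 0] u_L2T(3)[of 0]
    by (intro notI, elim allE[of _ "u 0"] allE[of _ "u_t 0"] allE[of _ u] allE[of _ u_t]) simp
  then show ?thesis using GCC_G by (simp add: G assms(1))
qed

end
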